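(* Let $f:\mathbb{R}^d\to\mathbb{R}$ be $\mu$-strongly convex and $L$-smooth and consider noisy GMM on $f$ with initialization $z_0=[x_0^\top,x_{-1}^\top]^\top\in\mathbb{R}^{2d}$, with sub-Gaussian gradient noise and with parameters $(\alpha,\beta,\gamma)=(\alpha_{\vartheta,\psi},\beta_{\vartheta,\psi},\gamma_{\vartheta,\psi})$, $(\vartheta,\psi)\in\mathcal{S}_0\cup\mathcal{S}_c$, as described in the context. Let $\rho^2=1-\sqrt{\vartheta\alpha\mu}$, $\lambda_P=\frac{\vartheta}{2\alpha}$ and $$\hat{\mathtt v}=\frac{2L^2}{\mu}\left(2(\beta-\gamma)^2+(1-\alpha L)^2(1+2\gamma+2\gamma^2)\right)+\lambda_P\rho^2.$$ If the risk-averseness parameter $\theta>0$ satisfies $$\theta<\theta_u^{sg}:=\min\left\{\frac{1-\rho^2}{64\alpha^2\hat{\mathtt v}},\ \frac1{4\alpha^2(L+2\lambda_P)}\right\},$$ then for every $k\ge0$ the finite-horizon entropic risk satisfies $$r_{k,\sigma^2}(\theta)<\frac{4\sigma^2\alpha^2(L+2\lambda_P)}{1-\hat\rho^2}+\hat\rho^{2k}\,2\mathcal{V}_P(z_0),$$ where $\hat\rho^2<1$ is given by $$\hat\rho^2=\frac12\left(\rho^2+32\alpha^2\hat{\mathtt v}\theta\right)+\frac12\sqrt{\left(\rho^2+32\alpha^2\hat{\mathtt v}\theta\right)^2+128\alpha^2\hat{\mathtt v}\theta}.$$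
   Context: $0<\mu<L$, $\kappa=L/\mu$, $x_*$ is the unique minimizer of $f$. The noisy generalized momentum method (GMM) with parameters $(\alpha,\beta,\gamma)$ and deterministic initialization $x_0,x_{-1}\in\mathbb{R}^d$ is $$x_{k+1}=(1+\beta)x_k-\beta x_{k-1}-\alpha\left(\nabla f(y_k)+w_{k+1}\right),\qquad y_k=(1+\gamma)x_k-\gamma x_{k-1},\qquad k\ge0.$$ Sub-Gaussian noise assumption: for each $k$, $w_{k+1}$ is independent of the natural filtration $\mathcal{F}_k$ generated by $x_0,\dots,x_k$, and is centered and sub-Gaussian with variance proxy $\sigma^2>0$, i.e. $\mathbb{E}[w_{k+1}\mid\mathcal{F}_k]=0$ and $\mathbb{P}\{\|w_{k+1}\|\ge t\mid\mathcal{F}_k\}\le2e^{-t^2/(2\sigma^2)}$. Put $z_k=[x_k^\top,x_{k-1}^\top]^\top$, $z_*=[x_*^\top,x_*^\top]^\top$. Parameter choice. Let $\mathcal{S}_0=\{(1,1)\}$, $\mathcal{S}_+=\{(\vartheta,\psi)\mid\psi>1,\ 1<\vartheta\le2-\frac1\psi\}$, $\mathcal{S}_-=\{(\vartheta,\psi)\mid0\le\psi<1,\ \max\{2-\frac1\psi,\frac1{1+\kappa(1-\psi)}\}\le\vartheta<1\}$ (for $\psi=0$ the maximum is read as $\frac1{1+\kappa}$), $$\mathcal{S}_1=\left\{(\vartheta,\psi)\;\middle|\;\psi\ne1,\ \left[1-\sqrt{\tfrac{(1-\vartheta)\vartheta}{\kappa(1-\psi)}}\right]\left[1-\tfrac{(1-\vartheta)(\mu\psi^2-L(1-\psi)^2)}{L(1-\psi)\vartheta}\right]\le\left[1-\tfrac{(1-\vartheta)\psi}{\kappa(1-\psi)}\right]^2\right\},$$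 $\mathcal{S}_c=(\mathcal{S}_-\cup\mathcal{S}_+)\cap\mathcal{S}_1$. For $(\vartheta,\psi)\in\mathcal{S}_0\cup\mathcal{S}_c$: $\alpha_{\vartheta,\psi}=\frac{1-\vartheta}{L(1-\psi)}$ if $(\vartheta,\psi)\in\mathcal{S}_c$, $\alpha_{\vartheta,\psi}$ is any number in $(0,\frac1L]$ if $(\vartheta,\psi)\in\mathcal{S}_0$; $\beta_{\vartheta,\psi}=\frac{1-\sqrt{\vartheta\alpha_{\vartheta,\psi}\mu}}{1-\alpha_{\vartheta,\psi}\psi\mu}\left[1-\sqrt{\frac{\alpha_{\vartheta,\psi}\mu}{\vartheta}}\right]$; $\gamma_{\vartheta,\psi}=\psi\beta_{\vartheta,\psi}$. Lyapunov function: $\mathcal{V}_P(z_k)=(z_k-z_* )^\top P(z_k-z_* )+f(x_k)-f(x_* )$ with $P=(\tilde p\tilde p^\top)\otimes I_d$, $\tilde p=\left[\sqrt{\frac{\vartheta}{2\alpha}},\ -\sqrt{\frac{\vartheta}{2\alpha}}+\sqrt{\frac\mu2}\right]^\top$. Entropic risk: $r_{k,\sigma^2}(\theta)=\frac{2\sigma^2}{\theta}\log\mathbb{E}\left[e^{\frac{\theta}{2\sigma^2}(f(x_k)-f(x_* ))}\right]$. *)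

theory Defs
  imports "HOL-Probability.Probability"
begin

section \<open>The function class\<close>

text \<open>Only meaningful at points where \<open>f\<close> is differentiable; there the gradient is unique.\<close>

definition grad :: "(real^'n \<Rightarrow> real) \<Rightarrow> real^'n \<Rightarrow> real^'n" where
  "grad f x = (THE D. GDERIV f x :> D)"

definition smooth :: "real \<Rightarrow> (real^'n \<Rightarrow> real) \<Rightarrow> bool" where
  "smooth L f \<longleftrightarrow> (\<forall>x. f differentiable (at x)) \<and> L-lipschitz_on UNIV (grad f)"

definition strongly_convex :: "real \<Rightarrow> (real^'n \<Rightarrow> real) \<Rightarrow> bool" where
  "strongly_convex \<mu> f \<longleftrightarrow> convex_on UNIV (\<lambda>x. f x - \<mu> / 2 * (norm x)\<^sup>2)"

definition unique_minimizer :: "(real^'n \<Rightarrow> real) \<Rightarrow> real^'n \<Rightarrow> bool" where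
  "unique_minimizer f x \<longleftrightarrow>
     is_arg_min f (\<lambda>_. True) x \<and> (\<forall>y. is_arg_min f (\<lambda>_. True) y \<longrightarrow> y = x)"

section \<open>The generalized momentum method\<close>

text \<open>The \<open>k\<close>-th state consists of the \<open>k\<close>-th iterate and its predecessor; the argument \<open>w\<close> is one realization of
  the noise sequence, of which only \<open>w 1, w 2, \<dots>\<close> are used.\<close>

primrec gmm_state ::
  "(real^'n \<Rightarrow> real) \<Rightarrow> real \<Rightarrow> real \<Rightarrow> real \<Rightarrow> real^'n \<Rightarrow> real^'n \<Rightarrow> (nat \<Rightarrow> real^'n)
    \<Rightarrow> nat \<Rightarrow> (real^'n) \<times> (real^'n)" where
  "gmm_state f \<alpha> \<beta> \<gamma> x0 xm1 w 0 = (x0, xm1)"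
| "gmm_state f \<alpha> \<beta> \<gamma> x0 xm1 w (Suc k) =
    (let (x, x') = gmm_state f \<alpha> \<beta> \<gamma> x0 xm1 w k;
         y = (1 + \<gamma>) *\<^sub>R x - \<gamma> *\<^sub>R x'
     in ((1 + \<beta>) *\<^sub>R x - \<beta> *\<^sub>R x' - \<alpha> *\<^sub>R (grad f y + w (Suc k)), x))"

definition gmm ::
  "(real^'n \<Rightarrow> real) \<Rightarrow> real \<Rightarrow> real \<Rightarrow> real \<Rightarrow> real^'n \<Rightarrow> real^'n \<Rightarrow> (nat \<Rightarrow> 'w \<Rightarrow> real^'n)
    \<Rightarrow> nat \<Rightarrow> 'w \<Rightarrow> real^'n" where
  "gmm f \<alpha> \<beta> \<gamma> x0 xm1 w k \<omega> = fst (gmm_state f \<alpha> \<beta> \<gamma> x0 xm1 (\<lambda>j. w j \<omega>) k)"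

section \<open>The noise model\<close>

definition natural_filtration ::
  "'w measure \<Rightarrow> (nat \<Rightarrow> 'w \<Rightarrow> real^'n) \<Rightarrow> nat \<Rightarrow> 'w measure" where
  "natural_filtration M X k =
     sigma (space M) (\<Union>i\<le>k. {X i -` A \<inter> space M | A. A \<in> sets borel})"

text \<open>\<^const>\<open>real_cond_exp\<close> is scalar, so the vector-valued conditional mean is taken
  coordinatewise. The tail bound entails integrability of the noise.\<close>

definition subgaussian_noise ::
  "'w measure \<Rightarrow> (nat \<Rightarrow> 'w \<Rightarrow> real^'n) \<Rightarrow> (nat \<Rightarrow> 'w \<Rightarrow> real^'n) \<Rightarrow> real \<Rightarrow> bool" where
  "subgaussian_noise M X w \<sigma> \<longleftrightarrow> (\<forall>k.
     w (Suc k) \<in> borel_measurable M \<and>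
     prob_space.indep_set M {w (Suc k) -` A \<inter> space M | A. A \<in> sets borel}
       (sets (natural_filtration M X k)) \<and>
     (\<forall>i. AE \<omega> in M.
        real_cond_exp M (natural_filtration M X k) (\<lambda>\<omega>. w (Suc k) \<omega> $ i) \<omega> = 0) \<and>
     (\<forall>t\<ge>0. AE \<omega> in M.
        real_cond_exp M (natural_filtration M X k)
          (indicator {\<omega> \<in> space M. norm (w (Suc k) \<omega>) \<ge> t}) \<omega>
        \<le> 2 * exp (- t\<^sup>2 / (2 * \<sigma>\<^sup>2))))"

section \<open>Parameters, as pairs \<open>(vartheta, \<psi>)\<close>\<close>

definition S_zero :: "(real \<times> real) set" where
  "S_zero = {(1, 1)}"

definition S_plus :: "(real \<times> real) set" where
  "S_plus = {(vartheta, \<psi>). \<psi> > 1 \<and> 1 < vartheta \<and> vartheta \<le> 2 - 1 / \<psi>}"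

text \<open>The case \<open>\<psi> = 0\<close> is separate because there \<open>1 / \<psi>\<close> is \<open>0\<close> in HOL,
  whereas the intended value of \<open>2 - 1 / \<psi>\<close> is minus infinity.\<close>

definition S_minus :: "real \<Rightarrow> (real \<times> real) set" where
  "S_minus \<kappa> = {(vartheta, \<psi>). 0 \<le> \<psi> \<and> \<psi> < 1 \<and>
     (if \<psi> = 0 then 1 / (1 + \<kappa>) else max (2 - 1 / \<psi>) (1 / (1 + \<kappa> * (1 - \<psi>)))) \<le> vartheta \<and>
     vartheta < 1}"

text \<open>On \<open>S_minus\<close> and \<open>S_plus\<close> the argument of the square root is nonnegative and no
  denominator vanishes; elsewhere \<open>S_one\<close> is not used.\<close>

definition S_one :: "real \<Rightarrow> real \<Rightarrow> (real \<times> real) set" where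
  "S_one \<mu> L = {(vartheta, \<psi>). \<psi> \<noteq> 1 \<and>
     (let \<kappa> = L / \<mu> in
       (1 - sqrt ((1 - vartheta) * vartheta / (\<kappa> * (1 - \<psi>)))) *
       (1 - (1 - vartheta) * (\<mu> * \<psi>\<^sup>2 - L * (1 - \<psi>)\<^sup>2) / (L * (1 - \<psi>) * vartheta))
       \<le> (1 - (1 - vartheta) * \<psi> / (\<kappa> * (1 - \<psi>)))\<^sup>2)}"

definition S_c :: "real \<Rightarrow> real \<Rightarrow> (real \<times> real) set" where
  "S_c \<mu> L = (S_minus (L / \<mu>) \<union> S_plus) \<inter> S_one \<mu> L"

definition gmm_parameters ::
  "real \<Rightarrow> real \<Rightarrow> real \<Rightarrow> real \<Rightarrow> real \<Rightarrow> real \<Rightarrow> real \<Rightarrow> bool" where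
  "gmm_parameters \<mu> L vartheta \<psi> \<alpha> \<beta> \<gamma> \<longleftrightarrow>
     ((vartheta, \<psi>) \<in> S_c \<mu> L \<and> \<alpha> = (1 - vartheta) / (L * (1 - \<psi>)) \<or>
      (vartheta, \<psi>) \<in> S_zero \<and> 0 < \<alpha> \<and> \<alpha> \<le> 1 / L) \<and>
     \<beta> = (1 - sqrt (vartheta * \<alpha> * \<mu>)) / (1 - \<alpha> * \<psi> * \<mu>) * (1 - sqrt (\<alpha> * \<mu> / vartheta)) \<and>
     \<gamma> = \<psi> * \<beta>"

section \<open>The Lyapunov function\<close>

text \<open>The space of vectors \<open>z\<close> made of two stacked blocks is \<open>real^(2 \<times> 'n)\<close>;
  the first index component selects the block. The Kronecker product uses the same indexing.\<close>

definition stack :: "real^'n \<Rightarrow> real^'n \<Rightarrow> real^(2 \<times> 'n)" where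
  "stack u v = (\<chi> p. if fst p = 1 then u $ snd p else v $ snd p)"

definition first_block :: "real^(2 \<times> 'n) \<Rightarrow> real^'n" where
  "first_block z = (\<chi> i. z $ (1, i))"

definition kronecker :: "real^'b^'a \<Rightarrow> real^'d^'c \<Rightarrow> real^('b \<times> 'd)^('a \<times> 'c)" where
  "kronecker A B = (\<chi> p q. A $ fst p $ fst q * B $ snd p $ snd q)"

definition p_tilde :: "real \<Rightarrow> real \<Rightarrow> real \<Rightarrow> real^2" where
  "p_tilde \<mu> vartheta \<alpha> = vector [sqrt (vartheta / (2 * \<alpha>)), - sqrt (vartheta / (2 * \<alpha>)) + sqrt (\<mu> / 2)]"

definition P_matrix :: "real \<Rightarrow> real \<Rightarrow> real \<Rightarrow> real^(2 \<times> 'n::finite)^(2 \<times> 'n)" where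
  "P_matrix \<mu> vartheta \<alpha> =
     kronecker ((columnvector (p_tilde \<mu> vartheta \<alpha>) :: real^1^2) ** rowvector (p_tilde \<mu> vartheta \<alpha>)) (mat 1)"

definition lyapunov ::
  "(real^'n \<Rightarrow> real) \<Rightarrow> real^'n \<Rightarrow> real^(2 \<times> 'n)^(2 \<times> 'n) \<Rightarrow> real^(2 \<times> 'n) \<Rightarrow> real" where
  "lyapunov f xs P z =
     (z - stack xs xs) \<bullet> (P *v (z - stack xs xs)) + f (first_block z) - f xs"

section \<open>The entropic risk\<close>

text \<open>The Bochner integral of a nonintegrable function is \<open>0\<close>, so the case of an infinite
  exponential moment, where the risk is infinite, is made explicit.\<close>

definition entropic_risk :: "'w measure \<Rightarrow> real \<Rightarrow> real \<Rightarrow> ('w \<Rightarrow> real) \<Rightarrow> ereal" where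
  "entropic_risk M \<sigma> \<theta> Y =
     (if integrable M (\<lambda>\<omega>. exp (\<theta> / (2 * \<sigma>\<^sup>2) * Y \<omega>))
      then ereal (2 * \<sigma>\<^sup>2 / \<theta> * ln (\<integral>\<omega>. exp (\<theta> / (2 * \<sigma>\<^sup>2) * Y \<omega>) \<partial>M))
      else \<infinity>)"

end

theory Submission
  imports Defs
begin

text \<open>
  The energy \<open>V\<close> (the Lyapunov function) dominates the suboptimality, so it is enough to bound its
  exponential moments. Three facts make this work.

  First, without noise one step of the method multiplies the energy by at most \<open>rho_sq\<close>
  (\<open>gmm_noiseless_contraction\<close>). The quadratic form that measures the defect in this inequality is
  diagonalised by the formulas for \<open>\<alpha>\<close>, \<open>\<beta>\<close> and \<open>\<gamma>\<close>, and the parameter sets guarantee that its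
  two remaining diagonal entries are nonpositive.

  Second, the noise shifts the new iterate, which changes the energy by a linear term along the
  gradient \<open>G\<close> of the energy and a quadratic term in the noise (\<open>energy_noisy_step\<close>). For
  sub-Gaussian noise the exponential moment of the linear term is controlled by \<open>(norm G)\<^sup>2\<close>
  (\<open>subgaussian_quadratic_mgf_le\<close>), and \<open>(norm G)\<^sup>2\<close> is at most \<open>2 * L + 4 * lambda_P\<close> times the
  energy of the noiseless iterate (\<open>energy_grad_bound\<close>), a consequence of smoothness. For
  \<open>\<tau> \<le> \<theta> / (2 * \<sigma>\<^sup>2)\<close> this gives
  \<open>E (exp (\<tau> * V (k + 1))) \<le> E (exp (\<tau> * (q * V k + c)))\<close> with \<open>q = rho_sq + 64 * \<alpha>\<^sup>2 * v_hat * \<theta>\<close>,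
  provided that \<open>(2 * L + 4 * lambda_P) * rho_sq \<le> 16 * v_hat\<close>. Iterating with the exponents
  \<open>\<tau>, \<tau> * q, \<tau> * q\<^sup>2, \<dots>\<close> yields the bound \<open>q ^ k * V 0 + c / (1 - q)\<close> on the risk.

  Third, the proviso holds because \<open>L \<le> 6 * lambda_P\<close>, that is \<open>\<alpha> * L \<le> 3 * vartheta\<close>, on the
  whole parameter set. This is where \<open>S_one\<close> enters a second time: on \<open>S_minus\<close> it forces
  \<open>vartheta \<ge> 1 / 2\<close> (\<open>S_one_imp_vartheta_ge_half\<close>).

  Finally \<open>q \<le> rho_hat_sq < 1\<close>, since \<open>rho_hat_sq\<close> is the root of
  \<open>x = rho_sq + B + B / x\<close> with \<open>B = 32 * \<alpha>\<^sup>2 * v_hat * \<theta>\<close> (\<open>rate_bounds\<close>).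
\<close>

section \<open>Gradient inequalities\<close>

text \<open>By finite dimension the derivative is represented by a vector, and this representation is
  unique; hence the definite description in \<^const>\<open>grad\<close> denotes it.\<close>

lemma smooth_has_derivative:
  fixes f :: "real^'n \<Rightarrow> real"
  assumes "smooth L f"
  shows "(f has_derivative (\<lambda>h. h \<bullet> grad f x)) (at x)"
proof -
  obtain f' where f': "(f has_derivative f') (at x)"
    using assms unfolding smooth_def differentiable_def by blast
  define D where "D = (\<Sum>b\<in>Basis. f' b *\<^sub>R b)"
  have lin: "linear f'" using f' has_derivative_linear by blast
  have "f' = (\<lambda>h. D \<bullet> h)"
  proof
    fix h
    have "f' h = f' (\<Sum>b\<in>Basis. (h \<bullet> b) *\<^sub>R b)" by (simp add: euclidean_representation)
    also have "\<dots> = (\<Sum>b\<in>Basis. (h \<bullet> b) * f' b)"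
      using lin by (simp add: linear_sum linear_scale)
    also have "\<dots> = D \<bullet> h" 
      by (simp only: D_def inner_sum_left inner_scaleR_left) (simp add: inner_commute mult.commute)
    finally show "f' h = D \<bullet> h" .
  qed
  then have D: "GDERIV f x :> D"
    using f' unfolding gderiv_def by (simp add: inner_commute)
  have uniq: "D' = D" if "GDERIV f x :> D'" for D'
  proof -
    have "(\<lambda>h. h \<bullet> D') = (\<lambda>h. h \<bullet> D)"
      using that D has_derivative_unique unfolding gderiv_def by blast
    then show ?thesis by (metis vector_eq_ldot)
  qed
  have "grad f x = D" unfolding grad_def by (rule the_equality) (fact D, fact uniq)
  with D show ?thesis unfolding gderiv_def by (simp only:)
qed

lemma smooth_DERIV_along_line:
  fixes f :: "real^'n \<Rightarrow> real"
  assumes "smooth L f"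
  shows "((\<lambda>t. f (x + t *\<^sub>R d)) has_real_derivative grad f (x + t *\<^sub>R d) \<bullet> d) (at t)"
proof -
  have "((\<lambda>t. f (x + t *\<^sub>R d)) has_derivative (\<lambda>h. (h *\<^sub>R d) \<bullet> grad f (x + t *\<^sub>R d))) (at t)"
    by (rule has_derivative_compose[where g = f and f = "\<lambda>t. x + t *\<^sub>R d",
          OF _ smooth_has_derivative[OF assms]]) (auto intro!: derivative_eq_intros)
  then show ?thesis
    unfolding has_field_derivative_def
    by (rule back_subst[of "\<lambda>F. (_ has_derivative F) _"]) (auto simp: inner_commute)
qed

text \<open>Along the segment from \<open>x\<close> to \<open>y\<close> the difference of the two sides has derivative of one
  sign, because the gradient moves by at most \<open>L\<close> times the distance travelled.\<close>

lemma smooth_upper_bound: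
  fixes f :: "real^'n \<Rightarrow> real"
  assumes "smooth L f"
  shows "f y \<le> f x + grad f x \<bullet> (y - x) + L / 2 * (norm (y - x))\<^sup>2"
proof -
  define d where "d = y - x"
  define \<phi> where "\<phi> t = f (x + t *\<^sub>R d) - t * (grad f x \<bullet> d) - L / 2 * t\<^sup>2 * (norm d)\<^sup>2" for t :: real
  have "\<phi> 1 \<le> \<phi> 0"
  proof (rule DERIV_nonpos_imp_nonincreasing[of 0 1 \<phi>])
    fix t :: real assume t: "0 \<le> t" "t \<le> 1"
    let ?D = "grad f (x + t *\<^sub>R d) \<bullet> d - grad f x \<bullet> d - L * t * (norm d)\<^sup>2"
    have "(\<phi> has_real_derivative ?D) (at t)"
      unfolding \<phi>_def
      by (auto intro!: derivative_eq_intros smooth_DERIV_along_line[OF assms])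
    moreover have "?D \<le> 0"
    proof -
      have "(grad f (x + t *\<^sub>R d) - grad f x) \<bullet> d \<le> norm (grad f (x + t *\<^sub>R d) - grad f x) * norm d"
        by (rule norm_cauchy_schwarz)
      also have "\<dots> \<le> (L * norm (t *\<^sub>R d)) * norm d"
        using lipschitz_on_normD[of L UNIV "grad f" "x + t *\<^sub>R d" x] assms
        by (intro mult_right_mono) (auto simp: smooth_def)
      finally show ?thesis using t by (simp add: inner_diff_left power2_eq_square algebra_simps)
    qed
    ultimately show "\<exists>y. (\<phi> has_real_derivative y) (at t) \<and> y \<le> 0" by blast
  qed simp
  then show ?thesis by (simp add: \<phi>_def d_def)
qed

text \<open>The convex function \<open>f z - \<mu> / 2 * (norm z)\<^sup>2\<close> lies above its tangent at \<open>x\<close>; it is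
  enough to look at its restriction to the line through \<open>x\<close> and \<open>y\<close>.\<close>

lemma strongly_convex_lower_bound:
  fixes f :: "real^'n \<Rightarrow> real"
  assumes "smooth L f" "strongly_convex \<mu> f"
  shows "f x + grad f x \<bullet> (y - x) + \<mu> / 2 * (norm (y - x))\<^sup>2 \<le> f y"
proof -
  define d where "d = y - x"
  define h where "h z = f z - \<mu> / 2 * (norm z)\<^sup>2" for z
  define \<phi> where "\<phi> t = h (x + t *\<^sub>R d)" for t :: real
  have h: "convex_on UNIV h"
    using assms(2) unfolding strongly_convex_def h_def by assumption
  have "convex_on UNIV \<phi>"
  proof (rule convex_onI)
    fix t a b :: real assume t: "0 < t" "t < 1"
    have "x + ((1 - t) *\<^sub>R a + t *\<^sub>R b) *\<^sub>R d = (1 - t) *\<^sub>R (x + a *\<^sub>R d) + t *\<^sub>R (x + b *\<^sub>R d)"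
      by (simp add: algebra_simps)
    then show "\<phi> ((1 - t) *\<^sub>R a + t *\<^sub>R b) \<le> (1 - t) * \<phi> a + t * \<phi> b"
      unfolding \<phi>_def using convex_onD[OF h, of t "x + a *\<^sub>R d" "x + b *\<^sub>R d"] t by simp
  qed simp
  moreover have D: "(\<phi> has_real_derivative grad f x \<bullet> d - \<mu> * (x \<bullet> d)) (at 0)"
  proof -
    have "(norm (x + t *\<^sub>R d))\<^sup>2 = x \<bullet> x + 2 * t * (x \<bullet> d) + t\<^sup>2 * (d \<bullet> d)" for t
      unfolding power2_norm_eq_inner
      by (simp only: inner_add_left inner_add_right inner_scaleR_left inner_scaleR_right
          inner_commute[of d x]) (simp add: power2_eq_square algebra_simps)
    moreover have "((\<lambda>t. f (x + t *\<^sub>R d) - \<mu> / 2 * (x \<bullet> x + 2 * t * (x \<bullet> d) + t\<^sup>2 * (d \<bullet> d)))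
      has_real_derivative grad f x \<bullet> d - \<mu> * (x \<bullet> d)) (at 0)"
      using smooth_DERIV_along_line[OF assms(1), of x d 0]
      by (auto intro!: derivative_eq_intros)
    ultimately show ?thesis unfolding \<phi>_def h_def by (simp only:)
  qed
  ultimately have "(grad f x \<bullet> d - \<mu> * (x \<bullet> d)) * (1 - 0) \<le> \<phi> 1 - \<phi> 0"
    by (intro convex_on_imp_above_tangent[where A = UNIV]) auto
  moreover have "\<phi> 1 = f y - \<mu> / 2 * ((norm x)\<^sup>2 + 2 * (x \<bullet> d) + (norm d)\<^sup>2)"
  proof -
    have "y = x + d" by (simp add: d_def)
    then have "(norm y)\<^sup>2 = (norm x)\<^sup>2 + 2 * (x \<bullet> d) + (norm d)\<^sup>2"
      unfolding power2_norm_eq_inner by (simp only: inner_add_left inner_add_right inner_commute[of d x])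
    with \<open>y = x + d\<close> show ?thesis by (simp add: \<phi>_def h_def)
  qed
  moreover have "\<phi> 0 = f x - \<mu> / 2 * (norm x)\<^sup>2" by (simp add: \<phi>_def h_def)
  ultimately show ?thesis unfolding d_def[symmetric] by (simp only: ring_distribs)
qed

text \<open>A gradient step of length \<open>1 / L\<close> lowers \<open>f\<close> by at least
  \<open>(norm (grad f x))\<^sup>2 / (2 * L)\<close>, and cannot go below the minimum.\<close>

lemma grad_norm_le_gap:
  fixes f :: "real^'n \<Rightarrow> real"
  assumes "smooth L f" "0 < L" "\<And>y. f xs \<le> f y"
  shows "(norm (grad f x))\<^sup>2 \<le> 2 * L * (f x - f xs)"
proof -
  have "f xs \<le> f (x - (1 / L) *\<^sub>R grad f x)" by (rule assms)
  also have "\<dots> \<le> f x - (norm (grad f x))\<^sup>2 / (2 * L)"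
  proof -
    let ?g = "grad f x"
    have "f (x - (1 / L) *\<^sub>R ?g) \<le> f x - (1 / L) * (norm ?g)\<^sup>2 + L / 2 * ((1 / L) * norm ?g)\<^sup>2"
      using smooth_upper_bound[OF assms(1), of "x - (1 / L) *\<^sub>R ?g" x] assms(2)
      by (simp add: dot_square_norm power_divide)
    also have "\<dots> = f x - (norm ?g)\<^sup>2 / (2 * L)"
      using assms(2) by (simp add: field_simps power2_eq_square)
    finally show ?thesis .
  qed
  finally show ?thesis using assms(2) by (simp add: field_simps)
qed

lemma continuous_on_smooth:
  fixes f :: "real^'n \<Rightarrow> real"
  assumes "smooth L f"
  shows "continuous_on UNIV f" "continuous_on UNIV (grad f)"
proof -
  show "continuous_on UNIV f"
    using smooth_has_derivative[OF assms] has_derivative_continuous continuous_at_imp_continuous_on by blast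
  show "continuous_on UNIV (grad f)"
    using assms lipschitz_on_continuous_on unfolding smooth_def by blast
qed

section \<open>The parameter sets\<close>

text \<open>Here \<open>T\<close> stands for \<open>1 / vartheta\<close>, \<open>e\<close> for \<open>1 - \<psi>\<close> and \<open>s\<close> for
  \<open>sqrt (\<alpha> * \<mu> / vartheta)\<close>; the conclusion is the negation of the inequality that defines
  \<^const>\<open>S_one\<close>. On the admissible range of \<open>e\<close> the difference \<open>E\<close> of the two sides is smallest
  at the left end \<open>e0\<close>, and there it factors as
  \<open>T\<^sup>2 * (N - s\<^sup>2) * ((T - 2) * (T - s) + (1 - s)\<^sup>2) / N\<^sup>2\<close>, which is positive for \<open>T > 2\<close>.
  For \<open>s = 1\<close> this changes sign at \<open>T = 2\<close>, so the threshold is sharp.\<close>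

lemma S_one_excludes_small_vartheta:
  fixes T e s :: real
  assumes T: "2 < T" and e: "(T - 1) / (2 * T - 1) \<le> e" "e \<le> 1" and s: "0 \<le> s" "s \<le> 1"
  shows "(T - s\<^sup>2 * (1 - e))\<^sup>2 < T * (T - s) * (1 + (T - 1) * e - s\<^sup>2 * (1 - e)\<^sup>2)"
proof -
  define N where "N = 2 * T - 1"
  define e0 where "e0 = (T - 1) / N"
  define E where "E x = T * (T - s) * (1 + (T - 1) * x - s\<^sup>2 * (1 - x)\<^sup>2) - (T - s\<^sup>2 * (1 - x))\<^sup>2" for x
  have N: "N > 3" using T by (simp add: N_def)
  have s2: "s\<^sup>2 \<le> 1" "s ^ 3 \<le> 1" using s by (auto simp: power_le_one)
  have "N\<^sup>2 * E e0 = T * (T - s) * (N\<^sup>2 + (T - 1) * N * (N * e0) - s\<^sup>2 * (N - N * e0)\<^sup>2)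
      - (T * N - s\<^sup>2 * (N - N * e0))\<^sup>2"
    unfolding E_def by (simp add: power2_eq_square algebra_simps)
  also have "N * e0 = T - 1" using N by (simp add: e0_def)
  also have "T * (T - s) * (N\<^sup>2 + (T - 1) * N * (T - 1) - s\<^sup>2 * (N - (T - 1))\<^sup>2)
      - (T * N - s\<^sup>2 * (N - (T - 1)))\<^sup>2 = T\<^sup>2 * (N - s\<^sup>2) * ((T - 2) * (T - s) + (1 - s)\<^sup>2) * 1"
    unfolding N_def by algebra
  finally have "N\<^sup>2 * E e0 = T\<^sup>2 * (N - s\<^sup>2) * ((T - 2) * (T - s) + (1 - s)\<^sup>2)" by simp
  moreover have "0 < \<dots>"
    using T N s s2 by (intro mult_pos_pos add_pos_nonneg) auto
  ultimately have "0 < E e0" using N by (metis zero_less_mult_pos zero_less_power less_trans zero_less_numeral)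
  moreover have "E e0 \<le> E e"
  proof -
    \<comment> \<open>The slope of the secant of \<open>E\<close> between \<open>e0\<close> and \<open>e\<close>; it decreases in \<open>e\<close>, and \<open>B1\<close> is its value at \<open>e = 1\<close>.\<close>
    define B where "B = T * (T - s) * (T - 1 + s\<^sup>2 * (2 - e - e0)) - s\<^sup>2 * (2 * T - 2 * s\<^sup>2 + s\<^sup>2 * (e + e0))"
    define B1 where "B1 = T * (T - s) * (T - 1 + s\<^sup>2 * (1 - e0)) - s\<^sup>2 * (2 * T - s\<^sup>2 * (1 - e0))"
    have "E e - E e0 = (e - e0) * B" unfolding E_def B_def by algebra
    moreover have "e0 \<le> e" using e by (simp add: e0_def N_def)
    moreover have "0 \<le> B"
    proof -
      have "B - B1 = (1 - e) * (T * (T - s) * s\<^sup>2 + s\<^sup>2 * s\<^sup>2)" unfolding B_def B1_def by algebra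
      also have "\<dots> \<ge> 0" using T s e by (intro mult_nonneg_nonneg add_nonneg_nonneg) auto
      finally have "B1 \<le> B" by simp
      have "N * B1 = T * (T - s) * ((T - 1) * N + s\<^sup>2 * (N - N * e0)) - s\<^sup>2 * (2 * T * N - s\<^sup>2 * (N - N * e0))"
        unfolding B1_def by (simp add: algebra_simps)
      also have "N * e0 = T - 1" using N by (simp add: e0_def)
      finally have NB: "N * B1 = T * ((T - s) * ((T - 1) * N + s\<^sup>2 * T) - 2 * s\<^sup>2 * N + s ^ 4)"
        unfolding N_def by algebra
      \<comment> \<open>Expanding around \<open>T = 2\<close> makes every coefficient visibly nonnegative.\<close>
      define v where "v = T - 2"
      have v: "v > 0" "T = 2 + v" using T by (auto simp: v_def)
      have "(T - s) * ((T - 1) * N + s\<^sup>2 * T) - 2 * s\<^sup>2 * N + s ^ 4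
        = (1 - s) * (6 + 3 * s + s\<^sup>2 - s ^ 3) + v * (3 + 2 * s\<^sup>2 + (2 - s) * (5 + s\<^sup>2) - 4 * s\<^sup>2)
          + v\<^sup>2 * (5 + s\<^sup>2 + 2 * (2 - s)) + 2 * v ^ 3"
        unfolding N_def v by algebra
      also have "\<dots> \<ge> 0"
      proof -
        have "(2 - s) * (5 + s\<^sup>2) \<ge> 1 * 5" using s by (intro mult_mono) auto
        moreover have "s ^ 3 \<le> 6 + 3 * s + s\<^sup>2" using s s2 zero_le_power2[of s] by linarith
        ultimately show ?thesis using s s2 v
          by (intro add_nonneg_nonneg mult_nonneg_nonneg) auto
      qed
      finally have "0 \<le> N * B1" using NB T by simp
      then have "0 \<le> B1" using N by (simp add: zero_le_mult_iff)
      with \<open>B1 \<le> B\<close> show ?thesis by simp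
    qed
    ultimately show ?thesis by (smt (verit) mult_nonneg_nonneg)
  qed
  ultimately show ?thesis unfolding E_def by simp
qed

text \<open>The hypothesis on \<open>\<psi> * (2 - vartheta)\<close> restates \<open>2 - 1 / \<psi> \<le> vartheta\<close> from
  \<^const>\<open>S_minus\<close>, in a form that also makes sense for \<open>\<psi> = 0\<close>.\<close>

lemma S_one_imp_vartheta_ge_half:
  fixes vartheta \<psi> u :: real
  assumes th: "0 < vartheta" and \<psi>: "0 \<le> \<psi>" "\<psi> * (2 - vartheta) \<le> 1" and u: "0 \<le> u" "u \<le> 1"
    and S: "(1 - vartheta * u) * (vartheta + (1 - vartheta) * (1 - \<psi>) - vartheta * u\<^sup>2 * \<psi>\<^sup>2)
        \<le> vartheta * (1 - vartheta * u\<^sup>2 * \<psi>)\<^sup>2"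
  shows "1 / 2 \<le> vartheta"
proof (rule ccontr)
  assume "\<not> 1 / 2 \<le> vartheta"
  then have small: "vartheta < 1 / 2" by simp
  define T where "T = 1 / vartheta"
  have T: "2 < T" "vartheta * T = 1" using th small by (auto simp: T_def field_simps)
  have "(T - 1) * vartheta = 1 - vartheta" "(2 * T - 1) * vartheta = 2 - vartheta"
    using T(2) by (simp_all add: algebra_simps)
  moreover have "1 - vartheta \<le> (1 - \<psi>) * (2 - vartheta)"
    using \<psi> by (simp add: algebra_simps)
  ultimately have "(T - 1) * vartheta \<le> (1 - \<psi>) * ((2 * T - 1) * vartheta)" by simp
  then have "(T - 1) / (2 * T - 1) \<le> 1 - \<psi>"
    using th T by (simp add: pos_divide_le_eq mult.assoc[symmetric])
  then have "(T - u\<^sup>2 * (1 - (1 - \<psi>)))\<^sup>2 < T * (T - u) * (1 + (T - 1) * (1 - \<psi>) - u\<^sup>2 * (1 - (1 - \<psi>))\<^sup>2)"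
    using T \<psi> u by (intro S_one_excludes_small_vartheta) auto
  then have "vartheta ^ 3 * (T - u\<^sup>2 * \<psi>)\<^sup>2
      < vartheta ^ 3 * (T * (T - u) * (1 + (T - 1) * (1 - \<psi>) - u\<^sup>2 * \<psi>\<^sup>2))"
    using th by simp
  moreover have "vartheta ^ 3 * (T - u\<^sup>2 * \<psi>)\<^sup>2 = vartheta * (vartheta * T - vartheta * u\<^sup>2 * \<psi>)\<^sup>2"
    by algebra
  moreover have "vartheta ^ 3 * (T * (T - u) * (1 + (T - 1) * (1 - \<psi>) - u\<^sup>2 * \<psi>\<^sup>2))
      = (vartheta * T) * (vartheta * T - vartheta * u)
          * (vartheta + (vartheta * T - vartheta) * (1 - \<psi>) - vartheta * u\<^sup>2 * \<psi>\<^sup>2)"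
    by algebra
  ultimately show False using S T by simp
qed

text \<open>Everything that the analysis of the method uses about the parameter sets. On \<^const>\<open>S_c\<close> the bound
  \<open>\<alpha> * L \<le> 2 - vartheta\<close> encodes \<open>vartheta \<le> 2 - 1 / \<psi>\<close> or \<open>vartheta \<ge> 2 - 1 / \<psi>\<close>, depending on the
  sign of \<open>1 - \<psi>\<close>, and the last inequality is \<^const>\<open>S_one\<close> with denominators cleared. The bound
  \<open>\<alpha> * L \<le> 3 * vartheta\<close> is the one that is not immediate: for \<open>vartheta \<ge> 1\<close> it follows from
  \<open>\<alpha> * L \<le> 1\<close>, and for \<open>vartheta < 1\<close> from \<open>vartheta \<ge> 1 / 2\<close> and
  \<open>\<alpha> * L \<le> 2 - vartheta \<le> 3 / 2\<close>.\<close>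

lemma gmm_parameters_facts:
  assumes \<mu>: "0 < \<mu>" "\<mu> < L" and par: "gmm_parameters \<mu> L vartheta \<psi> \<alpha> \<beta> \<gamma>"
  shows "0 < \<alpha>" "0 < vartheta" "vartheta * \<alpha> * \<mu> < 1" "\<alpha> * L * (1 - \<psi>) = 1 - vartheta"
    "\<alpha> * L \<le> 2 - vartheta" "\<alpha> * L \<le> 3 * vartheta" "\<alpha> * \<mu> * \<psi> < 1"
    "(1 - sqrt (vartheta * \<alpha> * \<mu>)) * (vartheta + (1 - vartheta) * (1 - \<psi>) - \<alpha> * \<mu> * \<psi>\<^sup>2)
        \<le> vartheta * (1 - \<alpha> * \<mu> * \<psi>)\<^sup>2"
proof -
  define a where "a = \<alpha> * L"
  define q where "q = \<alpha> * \<mu>"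
  have L: "0 < L" using \<mu> by simp
  have fin: "0 < \<alpha> \<and> 0 < vartheta \<and> vartheta * \<alpha> * \<mu> < 1 \<and> \<alpha> * L * (1 - \<psi>) = 1 - vartheta \<and>
    \<alpha> * L \<le> 2 - vartheta \<and> \<alpha> * L \<le> 3 * vartheta \<and> \<alpha> * \<mu> * \<psi> < 1 \<and>
    (1 - sqrt (vartheta * \<alpha> * \<mu>)) * (vartheta + (1 - vartheta) * (1 - \<psi>) - \<alpha> * \<mu> * \<psi>\<^sup>2)
        \<le> vartheta * (1 - \<alpha> * \<mu> * \<psi>)\<^sup>2"
  proof (cases "(vartheta, \<psi>) \<in> S_zero")
    case True
    then have one: "vartheta = 1" "\<psi> = 1" by (auto simp: S_zero_def)
    have \<alpha>: "0 < \<alpha>" "\<alpha> \<le> 1 / L"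
      using par True by (auto simp: gmm_parameters_def S_c_def S_one_def S_zero_def)
    then have a: "\<alpha> * L \<le> 1" using L by (simp add: field_simps)
    then have q: "0 < q" "q < 1"
      using \<alpha> \<mu> mult_strict_left_mono[OF \<mu>(2) \<alpha>(1)] unfolding q_def by (simp, linarith)
    have "q \<le> sqrt q" using q by (intro real_le_rsqrt) (simp add: power2_eq_square mult_left_le)
    then have "(1 - sqrt q) * (1 - q) \<le> (1 - q) * (1 - q)" using q by (intro mult_right_mono) auto
    then show ?thesis using one \<alpha> a q by (simp add: q_def power2_eq_square)
  next
    case False
    then have Sc: "(vartheta, \<psi>) \<in> S_c \<mu> L" and \<alpha>: "\<alpha> = (1 - vartheta) / (L * (1 - \<psi>))"
      using par by (auto simp: gmm_parameters_def)
    have \<psi>1: "\<psi> \<noteq> 1" using Sc by (auto simp: S_c_def S_one_def)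
    then have a: "a * (1 - \<psi>) = 1 - vartheta" using L by (simp add: a_def \<alpha>)
    have qa: "q = a * \<mu> / L" using L by (simp add: a_def q_def)
    \<comment> \<open>\<open>S_plus\<close> and \<open>S_minus\<close> treated uniformly: \<open>a * \<psi> \<le> 1\<close> is their bound by \<open>2 - 1 / \<psi>\<close>, and
      \<open>q \<le> vartheta\<close> is the bound of \<open>S_minus\<close> that involves \<open>\<kappa>\<close>.\<close>
    have basic: "0 < vartheta \<and> 0 < a \<and> 0 \<le> \<psi> \<and> a * \<psi> \<le> 1 \<and> (vartheta < 1 \<longrightarrow> q \<le> vartheta) \<and> (1 < vartheta \<longrightarrow> 1 < \<psi>) \<and> vartheta \<noteq> 1"
    proof (cases "(vartheta, \<psi>) \<in> S_plus")
      case True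
      then have h: "1 < \<psi>" "1 < vartheta" "vartheta \<le> 2 - 1 / \<psi>" by (auto simp: S_plus_def)
      then have "vartheta * \<psi> \<le> 2 * \<psi> - 1" by (simp add: field_simps)
      moreover have "a * \<psi> * (\<psi> - 1) = (vartheta - 1) * \<psi>" using a by algebra
      ultimately have "a * \<psi> * (\<psi> - 1) \<le> 1 * (\<psi> - 1)" by (simp add: algebra_simps)
      then have "a * \<psi> \<le> 1" using h by simp
      moreover have "0 < a"
      proof -
        have "0 < a * (\<psi> - 1)" using a h by (simp add: algebra_simps)
        then show ?thesis using h by (simp add: zero_less_mult_iff)
      qed
      ultimately show ?thesis using h by auto
    next
      case False
      then have "(vartheta, \<psi>) \<in> S_minus (L / \<mu>)" using Sc by (auto simp: S_c_def)
      then have h: "0 \<le> \<psi>" "\<psi> < 1" "vartheta < 1" "1 / (1 + L / \<mu> * (1 - \<psi>)) \<le> vartheta"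
          "\<psi> \<noteq> 0 \<Longrightarrow> 2 - 1 / \<psi> \<le> vartheta"
        by (auto simp: S_minus_def split: if_splits)
      have pos: "0 < 1 + L / \<mu> * (1 - \<psi>)" using h L \<mu> by (intro add_pos_nonneg) auto
      have th: "0 < vartheta" using h(4) pos by (smt (verit) divide_pos_pos)
      have "1 \<le> vartheta * (1 + L / \<mu> * (1 - \<psi>))" using h(4) pos by (simp add: field_simps)
      then have "a * (1 - \<psi>) \<le> vartheta * (L / \<mu>) * (1 - \<psi>)" using a by (simp add: algebra_simps)
      then have "a \<le> vartheta * (L / \<mu>)" using h by (metis diff_gt_0_iff_gt mult_le_cancel_right_pos)
      then have "q \<le> vartheta" using L \<mu> by (simp add: qa field_simps)
      moreover have "0 < a" using a h by (metis diff_gt_0_iff_gt zero_less_mult_pos2)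
      moreover have "a * \<psi> \<le> 1"
      proof (cases "\<psi> = 0")
        case False
        then have "2 * \<psi> - 1 \<le> vartheta * \<psi>" using h by (simp add: field_simps)
        moreover have "a * \<psi> * (1 - \<psi>) = (1 - vartheta) * \<psi>" using a by algebra
        ultimately have "a * \<psi> * (1 - \<psi>) \<le> 1 * (1 - \<psi>)" by (simp add: algebra_simps)
        then show ?thesis using h by simp
      qed simp
      ultimately show ?thesis using h th by auto
    qed
    have \<alpha>0: "0 < \<alpha>" using basic L by (simp add: a_def zero_less_mult_iff)
    have a2: "a \<le> 2 - vartheta" using a basic by (simp add: algebra_simps)
    have q: "0 < q" "q < a" using \<alpha>0 \<mu> by (auto simp: q_def a_def)
    have q\<psi>: "q * \<psi> < 1"
    proof (cases "\<psi> = 0")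
      case False
      then have "q * \<psi> < a * \<psi>" using q basic by simp
      then show ?thesis using basic by linarith
    qed simp
    have "vartheta * q < 1"
    proof -
      have "vartheta * q < vartheta * (2 - vartheta)" using q a2 basic by (intro mult_strict_left_mono) auto
      also have "\<dots> \<le> 1" using zero_le_power2[of "vartheta - 1"] by (simp add: power2_eq_square algebra_simps)
      finally show ?thesis .
    qed
    have S: "(1 - sqrt (vartheta * q)) * (vartheta + (1 - vartheta) * (1 - \<psi>) - q * \<psi>\<^sup>2)
        \<le> vartheta * (1 - q * \<psi>)\<^sup>2"
    proof -
      have 1: "(1 - vartheta) * vartheta / (L / \<mu> * (1 - \<psi>)) = vartheta * q"
        and 3: "(1 - vartheta) * \<psi> / (L / \<mu> * (1 - \<psi>)) = q * \<psi>"
        using \<psi>1 L \<mu> by (simp_all add: q_def \<alpha>)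
      have "(1 - vartheta) * (\<mu> * \<psi>\<^sup>2 - L * (1 - \<psi>)\<^sup>2) / (L * (1 - \<psi>) * vartheta)
        = \<alpha> * (\<mu> * \<psi>\<^sup>2 - L * (1 - \<psi>)\<^sup>2) / vartheta" by (simp add: \<alpha>)
      also have "\<alpha> * (\<mu> * \<psi>\<^sup>2 - L * (1 - \<psi>)\<^sup>2) = q * \<psi>\<^sup>2 - (1 - vartheta) * (1 - \<psi>)"
        unfolding a[symmetric] by (simp add: q_def a_def power2_eq_square algebra_simps)
      finally have 2: "(1 - vartheta) * (\<mu> * \<psi>\<^sup>2 - L * (1 - \<psi>)\<^sup>2) / (L * (1 - \<psi>) * vartheta)
        = (q * \<psi>\<^sup>2 - (1 - vartheta) * (1 - \<psi>)) / vartheta" .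
      have "(1 - sqrt (vartheta * q)) * (1 - (q * \<psi>\<^sup>2 - (1 - vartheta) * (1 - \<psi>)) / vartheta) \<le> (1 - q * \<psi>)\<^sup>2"
        using Sc unfolding S_c_def S_one_def Let_def
        by (simp only: Int_iff mem_Collect_eq case_prod_conv 1 2 3)
      then have "vartheta * ((1 - sqrt (vartheta * q)) * (1 - (q * \<psi>\<^sup>2 - (1 - vartheta) * (1 - \<psi>)) / vartheta)) \<le> vartheta * (1 - q * \<psi>)\<^sup>2"
        using basic by (intro mult_left_mono) auto
      also have "vartheta * ((1 - sqrt (vartheta * q)) * (1 - (q * \<psi>\<^sup>2 - (1 - vartheta) * (1 - \<psi>)) / vartheta))
        = (1 - sqrt (vartheta * q)) * (vartheta * 1 - vartheta * ((q * \<psi>\<^sup>2 - (1 - vartheta) * (1 - \<psi>)) / vartheta))"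
        by (simp only: right_diff_distrib mult.left_commute)
      also have "vartheta * ((q * \<psi>\<^sup>2 - (1 - vartheta) * (1 - \<psi>)) / vartheta) = q * \<psi>\<^sup>2 - (1 - vartheta) * (1 - \<psi>)"
        using basic by simp
      finally show ?thesis by (simp add: diff_diff_eq2)
    qed
    have "a \<le> 3 * vartheta"
    proof (cases "vartheta < 1")
      case True
      define u where "u = sqrt (q / vartheta)"
      have u: "0 \<le> u" "u \<le> 1" "q = vartheta * u\<^sup>2"
        using q basic True by (auto simp: u_def)
      have "sqrt (vartheta * q) = vartheta * u"
        using u basic by (simp add: real_sqrt_mult power2_eq_square)
      moreover have "\<psi> * (2 - vartheta) \<le> 1"
      proof -
        have "(1 - vartheta) * \<psi> = a * \<psi> * (1 - \<psi>)" using a by algebra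
        also have "\<dots> \<le> 1 * (1 - \<psi>)"
        proof (intro mult_right_mono)
          have "0 < a * (1 - \<psi>)" using a True by simp
          then show "0 \<le> 1 - \<psi>" using basic by (simp add: zero_less_mult_iff)
        qed (use basic in auto)
        finally show ?thesis by (simp add: algebra_simps)
      qed
      ultimately have "1 / 2 \<le> vartheta"
        using S u basic by (intro S_one_imp_vartheta_ge_half[of vartheta \<psi> u]) auto
      then show ?thesis using a2 by simp
    next
      case False
      then have "1 < \<psi>" using basic by auto
      then have "a * 1 \<le> a * \<psi>" using basic by (intro mult_left_mono) auto
      then show ?thesis using basic False by linarith
    qed
    then show ?thesis using basic \<alpha>0 a a2 q q\<psi> S \<open>vartheta * q < 1\<close>
      by (simp add: q_def a_def mult.assoc)
  qed
  then show "0 < \<alpha>" "0 < vartheta" "vartheta * \<alpha> * \<mu> < 1" "\<alpha> * L * (1 - \<psi>) = 1 - vartheta"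
    "\<alpha> * L \<le> 2 - vartheta" "\<alpha> * L \<le> 3 * vartheta" "\<alpha> * \<mu> * \<psi> < 1"
    "(1 - sqrt (vartheta * \<alpha> * \<mu>)) * (vartheta + (1 - vartheta) * (1 - \<psi>) - \<alpha> * \<mu> * \<psi>\<^sup>2)
        \<le> vartheta * (1 - \<alpha> * \<mu> * \<psi>)\<^sup>2" by blast+
qed

section \<open>The energy\<close>

text \<open>The Lyapunov function with the Kronecker structure of its matrix multiplied out: \<open>p\<close> and
  \<open>m - p\<close> are the entries of \<^const>\<open>p_tilde\<close>, so \<open>p\<^sup>2\<close> is \<open>vartheta / (2 * \<alpha>)\<close> and \<open>m\<^sup>2\<close> is
  \<open>\<mu> / 2\<close>. Working with \<open>p\<close> and \<open>m\<close> keeps square roots out of the algebra.\<close>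

definition energy :: "(real^'n \<Rightarrow> real) \<Rightarrow> real^'n \<Rightarrow> real \<Rightarrow> real \<Rightarrow> real^'n \<Rightarrow> real^'n \<Rightarrow> real" where
  "energy f xs p m x x' = (norm (p *\<^sub>R (x - xs) + (m - p) *\<^sub>R (x' - xs)))\<^sup>2 + f x - f xs"

lemma energy_ge_gap: "f x - f xs \<le> energy f xs p m x x'"
  by (simp add: energy_def)

lemma energy_nonneg: "(\<And>y. f xs \<le> f y) \<Longrightarrow> 0 \<le> energy f xs p m x x'"
  using energy_ge_gap[of f x xs p m x'] by (metis diff_ge_0_iff_ge order_trans)


lemma lyapunov_eq_energy:
  fixes x x' xs :: "real^'n"
  shows "lyapunov f xs (P_matrix \<mu> vartheta \<alpha>) (stack x x')
    = energy f xs (sqrt (vartheta / (2 * \<alpha>))) (sqrt (\<mu> / 2)) x x'"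
proof -
  define p where "p = sqrt (vartheta / (2 * \<alpha>))"
  define m where "m = sqrt (\<mu> / 2)"
  define z where "z = stack x x' - stack xs xs"
  have z: "z $ (1, k) = (x - xs) $ k" "z $ (2, k) = (x' - xs) $ k" for k
    by (simp_all add: z_def stack_def)
  have P: "(P_matrix \<mu> vartheta \<alpha> :: real^(2 \<times> 'n)^(2 \<times> 'n)) $ i $ j
    = p_tilde \<mu> vartheta \<alpha> $ fst i * p_tilde \<mu> vartheta \<alpha> $ fst j * (if snd i = snd j then 1 else 0)" for i j
    by (simp add: P_matrix_def kronecker_def columnvector_def rowvector_def matrix_matrix_mult_def mat_def)
  have p: "p_tilde \<mu> vartheta \<alpha> $ 1 = p" "p_tilde \<mu> vartheta \<alpha> $ 2 = m - p"
    by (simp_all add: p_tilde_def p_def m_def)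
  have sum_pairs: "(\<Sum>i\<in>UNIV. h i) = (\<Sum>k\<in>UNIV. h (1, k) + h (2, k))" for h :: "2 \<times> 'n \<Rightarrow> real"
    using sum.cartesian_product[of "\<lambda>i k. h (i, k)" UNIV UNIV]
    by (simp add: sum_2 sum.distrib)
  have "z \<bullet> (P_matrix \<mu> vartheta \<alpha> *v z)
    = (\<Sum>k\<in>UNIV. (p * (x - xs) $ k + (m - p) * (x' - xs) $ k)\<^sup>2)"
    unfolding inner_vec_def matrix_vector_mult_def
    by (simp add: sum_pairs P p z if_distrib[of "\<lambda>c. c * _"] if_distrib[of "\<lambda>c. _ * c"]
          sum.distrib sum.delta power2_eq_square algebra_simps cong: if_cong)
  also have "\<dots> = (norm (p *\<^sub>R (x - xs) + (m - p) *\<^sub>R (x' - xs)))\<^sup>2"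
    unfolding power2_norm_eq_inner inner_vec_def by (simp add: power2_eq_square)
  moreover have "first_block (stack x x') = x"
    by (simp add: first_block_def stack_def vec_eq_iff)
  ultimately show ?thesis
    unfolding lyapunov_def energy_def z_def p_def m_def by simp
qed

text \<open>The vector on the left is the gradient of the energy in its first argument. Both summands are
  controlled by the energy, and Young's inequality with weight \<open>t\<close> balances the two bounds so that
  a common factor comes out.\<close>

lemma energy_grad_bound:
  fixes f :: "real^'n \<Rightarrow> real"
  assumes "smooth L f" "0 < L" "0 < p" "\<And>y. f xs \<le> f y"
  shows "(norm (grad f x + (2 * p) *\<^sub>R (p *\<^sub>R (x - xs) + (m - p) *\<^sub>R (x' - xs))))\<^sup>2
      \<le> (2 * L + 4 * p\<^sup>2) * energy f xs p m x x'"
proof -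
  define c where "c = p *\<^sub>R (x - xs) + (m - p) *\<^sub>R (x' - xs)"
  define t where "t = 2 * p\<^sup>2 / L"
  have t: "0 < t" using assms by (simp add: t_def)
  let ?a = "grad f x" and ?b = "(2 * p) *\<^sub>R c"
  have "0 \<le> (norm (t *\<^sub>R ?a - ?b))\<^sup>2 / t" using t by simp
  also have "\<dots> = t * (norm ?a)\<^sup>2 - 2 * (?a \<bullet> ?b) + (norm ?b)\<^sup>2 / t"
    using t unfolding power2_norm_eq_inner
    by (simp add: inner_diff_left inner_diff_right inner_commute field_simps power2_eq_square)
  also have "(norm ?b)\<^sup>2 / t = 2 * L * (norm c)\<^sup>2"
    using assms by (simp add: t_def power_mult_distrib field_simps power2_eq_square)
  finally have "2 * (?a \<bullet> ?b) \<le> t * (norm ?a)\<^sup>2 + 2 * L * (norm c)\<^sup>2" by simp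
  then have "(norm (?a + ?b))\<^sup>2 \<le> (1 + t) * (norm ?a)\<^sup>2 + (2 * L + 4 * p\<^sup>2) * (norm c)\<^sup>2"
    unfolding power2_norm_eq_inner
    by (simp add: inner_add_left inner_add_right inner_commute power2_eq_square algebra_simps)
  also have "(1 + t) * (norm ?a)\<^sup>2 \<le> (1 + t) * (2 * L * (f x - f xs))"
    using t by (intro mult_left_mono grad_norm_le_gap assms) auto
  also have "\<dots> = (2 * L + 4 * p\<^sup>2) * (f x - f xs)"
    using assms by (simp add: t_def field_simps)
  finally show ?thesis unfolding energy_def c_def by (simp add: algebra_simps)
qed

text \<open>The quadratic part of the energy is expanded exactly, and \<open>f\<close> by its smoothness bound; the
  noise thus enters through a linear term along the gradient of the energy and a quadratic term.\<close>

lemma energy_noisy_step: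
  fixes f :: "real^'n \<Rightarrow> real"
  assumes "smooth L f"
  shows "energy f xs p m (x - \<alpha> *\<^sub>R w) x' \<le> energy f xs p m x x'
    - \<alpha> * ((grad f x + (2 * p) *\<^sub>R (p *\<^sub>R (x - xs) + (m - p) *\<^sub>R (x' - xs))) \<bullet> w)
    + \<alpha>\<^sup>2 * (L / 2 + p\<^sup>2) * (norm w)\<^sup>2"
proof -
  define c where "c = p *\<^sub>R (x - xs) + (m - p) *\<^sub>R (x' - xs)"
  have "p *\<^sub>R (x - \<alpha> *\<^sub>R w - xs) + (m - p) *\<^sub>R (x' - xs) = c - (p * \<alpha>) *\<^sub>R w"
    by (simp add: c_def algebra_simps)
  moreover have "(norm (c - (p * \<alpha>) *\<^sub>R w))\<^sup>2
      = (norm c)\<^sup>2 - 2 * p * \<alpha> * (c \<bullet> w) + p\<^sup>2 * \<alpha>\<^sup>2 * (norm w)\<^sup>2"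
    unfolding power2_norm_eq_inner
    by (simp add: inner_diff_left inner_diff_right inner_commute power2_eq_square algebra_simps)
  moreover have "f (x - \<alpha> *\<^sub>R w) \<le> f x - \<alpha> * (grad f x \<bullet> w) + L / 2 * (\<alpha>\<^sup>2 * (norm w)\<^sup>2)"
    using smooth_upper_bound[OF assms, of "x - \<alpha> *\<^sub>R w" x] by (simp add: power_mult_distrib)
  ultimately show ?thesis
    unfolding energy_def c_def[symmetric]
    by (simp add: inner_add_left algebra_simps)
qed

section \<open>Contraction without noise\<close>

text \<open>Smoothness bounds \<open>f\<close> at the next iterate from its first-order data at the extrapolated point
  \<open>y\<close>; strong convexity at \<open>y\<close>, used towards \<open>x\<close> with weight \<open>1 - r\<close> and towards \<open>xs\<close> with weight
  \<open>r\<close>, bounds these data by the old function values. What remains is a quadratic form in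
  \<open>X = x - xs\<close>, \<open>d = x - x'\<close> and \<open>g = grad f y\<close>. The choices of \<open>p\<close>, \<open>m\<close> and \<open>r\<close> remove the terms in
  \<open>X \<bullet> X\<close> and \<open>X \<bullet> g\<close>, the formula for \<open>\<beta>\<close> the term in \<open>X \<bullet> d\<close>, and
  \<open>\<alpha> * L * (1 - \<psi>) = 1 - vartheta\<close> the term in \<open>d \<bullet> g\<close>. The two remaining squares have nonpositive
  coefficients: that of \<open>g\<close> by \<open>\<alpha> * L \<le> 2 - vartheta\<close>, that of \<open>d\<close> by \<^const>\<open>S_one\<close>.\<close>

lemma gmm_noiseless_contraction:
  fixes f :: "real^'n \<Rightarrow> real" and x x' xs :: "real^'n"
  assumes f: "smooth L f" "strongly_convex \<mu> f"
    and pos: "0 < \<alpha>" "0 < p" "0 < m"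
    and p: "2 * \<alpha> * p\<^sup>2 = vartheta" and m: "2 * m\<^sup>2 = \<mu>"
    and r: "r = 2 * \<alpha> * p * m" "r \<le> 1"
    and \<beta>: "\<beta> * p * (1 - \<alpha> * \<mu> * \<psi>) = (1 - r) * (p - m)" and \<gamma>: "\<gamma> = \<psi> * \<beta>"
    and a: "\<alpha> * L * (1 - \<psi>) = 1 - vartheta" "\<alpha> * L \<le> 2 - vartheta" "\<alpha> * \<mu> * \<psi> < 1"
    and S: "(1 - r) * (vartheta + (1 - vartheta) * (1 - \<psi>) - \<alpha> * \<mu> * \<psi>\<^sup>2)
        \<le> vartheta * (1 - \<alpha> * \<mu> * \<psi>)\<^sup>2"
  shows "energy f xs p m ((1 + \<beta>) *\<^sub>R x - \<beta> *\<^sub>R x' - \<alpha> *\<^sub>R grad f ((1 + \<gamma>) *\<^sub>R x - \<gamma> *\<^sub>R x')) x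
    \<le> (1 - r) * energy f xs p m x x'"
proof -
  define y where "y = (1 + \<gamma>) *\<^sub>R x - \<gamma> *\<^sub>R x'"
  define X where "X = x - xs"
  define d where "d = x - x'"
  define g where "g = grad f y"
  define xb where "xb = (1 + \<beta>) *\<^sub>R x - \<beta> *\<^sub>R x' - \<alpha> *\<^sub>R g"
  define XX Xd Xg dd dg gg where abbr: "XX = X \<bullet> X" "Xd = X \<bullet> d" "Xg = X \<bullet> g" "dd = d \<bullet> d" "dg = d \<bullet> g" "gg = g \<bullet> g"
  note inner_rules = inner_add_left inner_add_right inner_diff_left inner_diff_right inner_commute
  have r0: "0 \<le> r" using r pos by simp
  have e1: "xb - y = (\<beta> - \<gamma>) *\<^sub>R d - \<alpha> *\<^sub>R g" by (simp add: xb_def y_def d_def algebra_simps)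
  have I1: "f xb \<le> f y + ((\<beta> - \<gamma>) * dg - \<alpha> * gg)
      + L / 2 * ((\<beta> - \<gamma>)\<^sup>2 * dd - 2 * \<alpha> * (\<beta> - \<gamma>) * dg + \<alpha>\<^sup>2 * gg)"
    using smooth_upper_bound[OF f(1), of xb y]
    unfolding power2_norm_eq_inner g_def[symmetric] abbr e1
    by (simp add: inner_rules power2_eq_square algebra_simps)
  have e2: "x - y = - \<gamma> *\<^sub>R d" by (simp add: y_def d_def algebra_simps)
  have I2: "f y - \<gamma> * dg + \<mu> / 2 * (\<gamma>\<^sup>2 * dd) \<le> f x"
    using strongly_convex_lower_bound[OF f, of y x]
    unfolding power2_norm_eq_inner g_def[symmetric] abbr e2
    by (simp add: inner_rules power2_eq_square algebra_simps)
  have e3: "xs - y = - X - \<gamma> *\<^sub>R d" by (simp add: y_def d_def X_def algebra_simps)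
  have I3: "f y - (Xg + \<gamma> * dg) + \<mu> / 2 * (XX + 2 * \<gamma> * Xd + \<gamma>\<^sup>2 * dd) \<le> f xs"
    using strongly_convex_lower_bound[OF f, of y xs]
    unfolding power2_norm_eq_inner g_def[symmetric] abbr e3
    by (simp add: inner_rules power2_eq_square algebra_simps)
  define N1 where "N1 = (norm (p *\<^sub>R (xb - xs) + (m - p) *\<^sub>R (x - xs)))\<^sup>2"
  define N2 where "N2 = (norm (p *\<^sub>R (x - xs) + (m - p) *\<^sub>R (x' - xs)))\<^sup>2"
  have e4: "p *\<^sub>R (xb - xs) + (m - p) *\<^sub>R (x - xs) = (p * \<beta>) *\<^sub>R d - (p * \<alpha>) *\<^sub>R g + m *\<^sub>R X"
    by (simp add: xb_def d_def X_def algebra_simps)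
  have N1: "N1 = p\<^sup>2 * (\<beta>\<^sup>2 * dd - 2 * \<alpha> * \<beta> * dg + \<alpha>\<^sup>2 * gg) + 2 * p * m * (\<beta> * Xd - \<alpha> * Xg) + m\<^sup>2 * XX"
    unfolding N1_def e4 power2_norm_eq_inner abbr
    by (simp add: inner_rules power2_eq_square algebra_simps)
  have e5: "p *\<^sub>R (x - xs) + (m - p) *\<^sub>R (x' - xs) = m *\<^sub>R X + (p - m) *\<^sub>R d"
    by (simp add: d_def X_def algebra_simps)
  have N2: "N2 = m\<^sup>2 * XX + 2 * m * (p - m) * Xd + (p - m)\<^sup>2 * dd"
    unfolding N2_def e5 power2_norm_eq_inner abbr
    by (simp add: inner_rules power2_eq_square algebra_simps)
  define K where "K = vartheta + (1 - vartheta) * (1 - \<psi>) - \<alpha> * \<mu> * \<psi>\<^sup>2"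
  define D where "D = 1 - \<alpha> * \<mu> * \<psi>"
  define A where "A = p\<^sup>2 * \<alpha>\<^sup>2 - \<alpha> + L / 2 * \<alpha>\<^sup>2"
  define C where "C = p\<^sup>2 * \<beta>\<^sup>2 - (1 - r) * (p - m)\<^sup>2 + L / 2 * (\<beta> - \<gamma>)\<^sup>2 - \<mu> / 2 * \<gamma>\<^sup>2"
  have "A \<le> 0"
  proof -
    have "A = \<alpha> / 2 * (2 * \<alpha> * p\<^sup>2 - 2 + \<alpha> * L)" by (simp add: A_def power2_eq_square algebra_simps)
    also have "\<dots> \<le> 0" unfolding p using a pos by (intro mult_nonneg_nonpos) auto
    finally show ?thesis .
  qed
  have "C \<le> 0"
  proof -
    \<comment> \<open>Multiplying by \<open>p\<^sup>2 * D\<^sup>2\<close> eliminates \<open>\<beta>\<close> and leaves the inequality that defines \<open>S_one\<close>.\<close>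
    have e6: "2 * \<alpha> * C = \<beta>\<^sup>2 * K - 2 * \<alpha> * (1 - r) * (p - m)\<^sup>2"
    proof -
      have "2 * \<alpha> * C = \<beta>\<^sup>2 * (2 * \<alpha> * p\<^sup>2 + \<alpha> * L * (1 - \<psi>) * (1 - \<psi>) - \<alpha> * \<mu> * \<psi>\<^sup>2) - 2 * \<alpha> * (1 - r) * (p - m)\<^sup>2"
        unfolding C_def \<gamma> by (simp add: power2_eq_square algebra_simps)
      then show ?thesis unfolding p a(1) K_def .
    qed
    have e7: "\<beta> * p * D = (1 - r) * (p - m)" using \<beta> unfolding D_def .
    have "p\<^sup>2 * D\<^sup>2 * (2 * \<alpha> * C) = (\<beta> * p * D)\<^sup>2 * K - (2 * \<alpha> * p\<^sup>2) * D\<^sup>2 * (1 - r) * (p - m)\<^sup>2"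
      unfolding e6 by (simp add: power2_eq_square algebra_simps)
    also have "\<dots> = (1 - r) * (p - m)\<^sup>2 * ((1 - r) * K - vartheta * D\<^sup>2)"
      unfolding p e7 by (simp add: power2_eq_square algebra_simps)
    also have "\<dots> \<le> 0" using S r unfolding K_def D_def by (intro mult_nonneg_nonpos) auto
    finally have "p\<^sup>2 * D\<^sup>2 * (2 * \<alpha>) * C \<le> 0" by (simp add: mult.assoc)
    moreover have "0 < p\<^sup>2 * D\<^sup>2 * (2 * \<alpha>)" using pos a(3) by (simp add: D_def)
    ultimately show ?thesis by (metis mult_le_0_iff not_less)
  qed
  have eXd: "2 * p * m * \<beta> - (1 - r) * (2 * m * (p - m)) - r * \<mu> * \<gamma> = 0"
  proof -
    have "2 * p * m * \<beta> - (1 - r) * (2 * m * (p - m)) - r * \<mu> * \<gamma>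
      = 2 * m * (\<beta> * p * (1 - \<alpha> * \<mu> * \<psi>) - (1 - r) * (p - m))"
      unfolding \<gamma> r(1) by (simp add: algebra_simps)
    then show ?thesis using \<beta> by simp
  qed
  have edg: "- 2 * p\<^sup>2 * \<alpha> * \<beta> + (\<beta> - \<gamma>) - L * \<alpha> * (\<beta> - \<gamma>) + \<gamma> = 0"
  proof -
    have "- 2 * p\<^sup>2 * \<alpha> * \<beta> + (\<beta> - \<gamma>) - L * \<alpha> * (\<beta> - \<gamma>) + \<gamma> = \<beta> * (1 - 2 * \<alpha> * p\<^sup>2 - \<alpha> * L * (1 - \<psi>))"
      unfolding \<gamma> by (simp add: algebra_simps)
    then show ?thesis unfolding p a(1) by simp
  qed
  have "N1 + f xb - f xs - (1 - r) * (N2 + f x - f xs)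
      \<le> N1 - (1 - r) * N2 + (f y + ((\<beta> - \<gamma>) * dg - \<alpha> * gg)
      + L / 2 * ((\<beta> - \<gamma>)\<^sup>2 * dd - 2 * \<alpha> * (\<beta> - \<gamma>) * dg + \<alpha>\<^sup>2 * gg))
      - (1 - r) * (f y - \<gamma> * dg + \<mu> / 2 * (\<gamma>\<^sup>2 * dd))
      - r * (f y - (Xg + \<gamma> * dg) + \<mu> / 2 * (XX + 2 * \<gamma> * Xd + \<gamma>\<^sup>2 * dd))"
    using I1 mult_left_mono[OF I2, of "1 - r"] mult_left_mono[OF I3 r0] r(2)
    by (simp add: algebra_simps)
  also have "\<dots> = r * (m\<^sup>2 - \<mu> / 2) * XX
      + (2 * p * m * \<beta> - (1 - r) * (2 * m * (p - m)) - r * \<mu> * \<gamma>) * Xd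
      + (r - 2 * \<alpha> * p * m) * Xg
      + (- 2 * p\<^sup>2 * \<alpha> * \<beta> + (\<beta> - \<gamma>) - L * \<alpha> * (\<beta> - \<gamma>) + \<gamma>) * dg + A * gg + C * dd"
    unfolding N1 N2 A_def C_def by (simp add: field_simps)
  also have "\<dots> = A * gg + C * dd" using m r(1) eXd edg by simp
  also have "\<dots> \<le> 0" using \<open>A \<le> 0\<close> \<open>C \<le> 0\<close> by (simp add: abbr mult_nonpos_nonneg add_nonpos_nonpos)
  finally show ?thesis unfolding energy_def N1_def N2_def xb_def g_def y_def by simp
qed

section \<open>Exponential moments of sub-Gaussian vectors\<close>

text \<open>Layer-cake formula: \<open>exp (\<eta> * z\<^sup>2) - 1\<close> is the integral of \<open>\<eta> * exp (\<eta> * u)\<close> over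
  \<open>u\<close> up to \<open>z\<^sup>2\<close>. After exchanging the integrals the tail bound at \<open>sqrt u\<close> leaves an exponential
  integral.\<close>

lemma (in prob_space) nn_integral_exp_square_le:
  fixes Z :: "'a \<Rightarrow> real"
  assumes Z[measurable]: "Z \<in> borel_measurable M" and Z0: "\<And>\<omega>. 0 \<le> Z \<omega>"
    and tail: "\<And>t. 0 \<le> t \<Longrightarrow> prob {\<omega> \<in> space M. t \<le> Z \<omega>} \<le> 2 * exp (- t\<^sup>2 / (2 * \<sigma>\<^sup>2))"
    and \<sigma>: "0 < \<sigma>" and \<eta>: "0 \<le> \<eta>" "2 * \<eta> * \<sigma>\<^sup>2 < 1"
  shows "(\<integral>\<^sup>+\<omega>. ennreal (exp (\<eta> * (Z \<omega>)\<^sup>2)) \<partial>M) \<le> ennreal (1 + 4 * \<eta> * \<sigma>\<^sup>2 / (1 - 2 * \<eta> * \<sigma>\<^sup>2))"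
proof -
  interpret lb: pair_sigma_finite M lborel ..
  define c where "c = 1 / (2 * \<sigma>\<^sup>2) - \<eta>"
  have c: "0 < c" using \<sigma> \<eta> by (simp add: c_def field_simps)
  have layer: "ennreal (exp (\<eta> * z\<^sup>2)) = 1 + (\<integral>\<^sup>+u. ennreal (\<eta> * exp (\<eta> * u)) * indicator {0..z\<^sup>2} u \<partial>lborel)" for z
  proof -
    have "(\<integral>\<^sup>+u. ennreal (\<eta> * exp (\<eta> * u)) * indicator {0..z\<^sup>2} u \<partial>lborel) = exp (\<eta> * z\<^sup>2) - exp (\<eta> * 0)"
      using \<eta> by (intro nn_integral_FTC_Icc) (auto intro!: derivative_eq_intros)
    then show ?thesis using \<eta> by (simp flip: ennreal_1 ennreal_plus)
  qed
  have "(\<integral>\<^sup>+\<omega>. ennreal (exp (\<eta> * (Z \<omega>)\<^sup>2)) \<partial>M)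
      = 1 + (\<integral>\<^sup>+\<omega>. (\<integral>\<^sup>+u. ennreal (\<eta> * exp (\<eta> * u)) * indicator {0..(Z \<omega>)\<^sup>2} u \<partial>lborel) \<partial>M)"
    unfolding layer by (subst nn_integral_add) (auto simp: indicator_def emeasure_space_1)
  also have "(\<integral>\<^sup>+\<omega>. (\<integral>\<^sup>+u. ennreal (\<eta> * exp (\<eta> * u)) * indicator {0..(Z \<omega>)\<^sup>2} u \<partial>lborel) \<partial>M)
      = (\<integral>\<^sup>+u. (\<integral>\<^sup>+\<omega>. ennreal (\<eta> * exp (\<eta> * u)) * indicator {0..(Z \<omega>)\<^sup>2} u \<partial>M) \<partial>lborel)"
    by (rule lb.Fubini'[symmetric]) (simp add: indicator_def)
  also have "\<dots> \<le> (\<integral>\<^sup>+u. ennreal (2 * \<eta> * exp (- c * u)) * indicator {0..} u \<partial>lborel)"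
  proof (rule nn_integral_mono)
    fix u :: real
    show "(\<integral>\<^sup>+\<omega>. ennreal (\<eta> * exp (\<eta> * u)) * indicator {0..(Z \<omega>)\<^sup>2} u \<partial>M)
      \<le> ennreal (2 * \<eta> * exp (- c * u)) * indicator {0..} u"
    proof (cases "0 \<le> u")
      case True
      have eq: "indicator {0..(Z \<omega>)\<^sup>2} u = (indicator {\<omega> \<in> space M. sqrt u \<le> Z \<omega>} \<omega> :: ennreal)" if "\<omega> \<in> space M" for \<omega>
        using True Z0[of \<omega>] that real_sqrt_le_iff[of u "(Z \<omega>)\<^sup>2"] by (simp add: indicator_def)
      have "(\<integral>\<^sup>+\<omega>. ennreal (\<eta> * exp (\<eta> * u)) * indicator {0..(Z \<omega>)\<^sup>2} u \<partial>M)
        = (\<integral>\<^sup>+\<omega>. ennreal (\<eta> * exp (\<eta> * u)) * indicator {\<omega> \<in> space M. sqrt u \<le> Z \<omega>} \<omega> \<partial>M)"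
        by (intro nn_integral_cong) (simp only: eq)
      also have "\<dots> = ennreal (\<eta> * exp (\<eta> * u) * prob {\<omega> \<in> space M. sqrt u \<le> Z \<omega>})"
        using \<eta> by (subst nn_integral_cmult_indicator) (auto simp: emeasure_eq_measure ennreal_mult)
      also have "\<dots> \<le> ennreal (\<eta> * exp (\<eta> * u) * (2 * exp (- u / (2 * \<sigma>\<^sup>2))))"
        using tail[of "sqrt u"] True \<eta> by (intro ennreal_leI mult_left_mono) auto
      also have "\<eta> * exp (\<eta> * u) * (2 * exp (- u / (2 * \<sigma>\<^sup>2))) = 2 * \<eta> * exp (- c * u)"
        by (simp add: c_def exp_add[symmetric] algebra_simps)
      finally show ?thesis using True by simp
    qed (auto simp: indicator_def)
  qed
  also have "\<dots> = ennreal (0 - (- (2 * \<eta> / c) * exp (- c * 0)))"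
  proof (rule nn_integral_FTC_atLeast)
    have "((\<lambda>u. exp (- c * u)) \<longlongrightarrow> 0) at_top"
      using c by (intro filterlim_compose[OF exp_at_bot] filterlim_tendsto_neg_mult_at_bot[OF tendsto_const _ filterlim_ident]) auto
    then show "((\<lambda>u. - (2 * \<eta> / c) * exp (- c * u)) \<longlongrightarrow> 0) at_top"
      by (rule tendsto_mult_right_zero)
  qed (use \<eta> c in \<open>auto intro!: derivative_eq_intros\<close>)
  also have "0 - (- (2 * \<eta> / c) * exp (- c * 0)) = 4 * \<eta> * \<sigma>\<^sup>2 / (1 - 2 * \<eta> * \<sigma>\<^sup>2)"
    using \<sigma> \<eta> by (simp add: c_def field_simps)
  finally show ?thesis using \<sigma> \<eta> by (simp add: ennreal_plus[symmetric] del: ennreal_plus flip: ennreal_1)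
qed

text \<open>This turns a centred variable into its square inside the exponential. The coefficient is chosen
  with the estimate of the moment generating function below in mind: with coefficient \<open>1\<close> the
  third-order terms there would come out too large even for small arguments.\<close>

lemma exp_le_linear_plus_exp_square:
  fixes x :: real
  shows "exp x \<le> x + exp (4 / 5 * x\<^sup>2)"
proof -
  have lin: "1 + 4 / 5 * x\<^sup>2 \<le> exp (4 / 5 * x\<^sup>2)" by (rule exp_ge_add_one_self)
  consider "x \<le> 0" | "0 \<le> x" "x \<le> 1" | "1 \<le> x" by linarith
  then show ?thesis
  proof cases
    case 1
    define y where "y = - x"
    have y: "0 \<le> y" using 1 by (simp add: y_def)
    have "1 \<le> (1 - y + 4 / 5 * y\<^sup>2) * (1 + y + y\<^sup>2 / 2)"
    proof -
      have "(1 - y + 4 / 5 * y\<^sup>2) * (1 + y + y\<^sup>2 / 2) = 1 + (3 / 10 * y\<^sup>2 + 3 / 10 * y ^ 3 + 2 / 5 * y ^ 4)"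
        by (simp add: algebra_simps power2_eq_square power3_eq_cube power4_eq_xxxx)
      also have "\<dots> \<ge> 1" using y by simp
      finally show ?thesis .
    qed
    also have "\<dots> \<le> (1 - y + 4 / 5 * y\<^sup>2) * exp y"
    proof (intro mult_left_mono exp_lower_Taylor_quadratic y)
      have "1 - y + 4 / 5 * y\<^sup>2 = (1 - y / 2)\<^sup>2 + 11 / 20 * y\<^sup>2" by (simp add: power2_eq_square algebra_simps)
      then show "0 \<le> 1 - y + 4 / 5 * y\<^sup>2" by simp
    qed
    finally have "exp (- y) \<le> 1 - y + 4 / 5 * y\<^sup>2" by (simp add: exp_minus field_simps)
    then have "exp x \<le> 1 + x + 4 / 5 * x\<^sup>2" by (simp add: y_def)
    with lin show ?thesis by linarith
  next
    case 2
    obtain t where t: "\<bar>t\<bar> \<le> \<bar>x\<bar>" "exp x = (\<Sum>m<4. x ^ m / fact m) + exp t / fact 4 * x ^ 4"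
      using Maclaurin_exp_le[of x 4] by blast
    have "exp t \<le> exp 1" using t 2 by simp
    then have "exp t \<le> 272 / 100" using e_less_272 by linarith
    moreover have "x ^ 3 \<le> x\<^sup>2" "x ^ 4 \<le> x\<^sup>2" using 2 by (auto intro: power_decreasing)
    ultimately have "exp t / 24 * x ^ 4 \<le> 272 / 100 / 24 * x\<^sup>2" by (intro mult_mono) auto
    moreover have "exp x = 1 + x + x\<^sup>2 / 2 + x ^ 3 / 6 + exp t / 24 * x ^ 4"
      unfolding t(2) by (simp add: eval_nat_numeral fact_numeral)
    moreover have "0 \<le> x\<^sup>2" by simp
    ultimately show ?thesis using lin \<open>x ^ 3 \<le> x\<^sup>2\<close> by linarith
  next
    case 3
    show ?thesis
    proof (cases "5 / 4 \<le> x")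
      case True
      then have "x \<le> 4 / 5 * x\<^sup>2" by (simp add: power2_eq_square)
      then have "exp x \<le> exp (4 / 5 * x\<^sup>2)" by simp
      then show ?thesis using 3 by linarith
    next
      case False
      have e: "exp x \<le> 4"
      proof -
        have "3 / 4 * exp (x - 1) \<le> exp (- (x - 1)) * exp (x - 1)"
          using False exp_ge_add_one_self[of "- (x - 1)"] by (intro mult_right_mono) auto
        then have "exp (x - 1) \<le> 4 / 3" by (simp add: exp_add[symmetric])
        then have "exp 1 * exp (x - 1) \<le> 272 / 100 * (4 / 3)" using e_less_272 by (intro mult_mono) auto
        then show ?thesis by (simp add: exp_add[symmetric])
      qed
      have "exp x - exp (4 / 5 * x\<^sup>2) = exp x * (1 - exp (4 / 5 * x\<^sup>2 - x))"
        by (simp add: algebra_simps exp_add[symmetric])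
      also have "\<dots> \<le> exp x * (x * (1 - 4 / 5 * x))"
        using exp_ge_add_one_self[of "4 / 5 * x\<^sup>2 - x"]
        by (intro mult_left_mono) (auto simp: power2_eq_square algebra_simps)
      also have "\<dots> = x * (exp x * (1 - 4 / 5 * x))" by simp
      also have "\<dots> \<le> x * (4 * (1 / 5))"
        using 3 False e by (intro mult_left_mono mult_mono) auto
      also have "\<dots> \<le> x" using 3 by simp
      finally show ?thesis by simp
    qed
  qed
qed

lemma (in prob_space) integrable_exp_square:
  fixes Z :: "'a \<Rightarrow> real"
  assumes Z: "Z \<in> borel_measurable M" "\<And>\<omega>. 0 \<le> Z \<omega>"
    and tail: "\<And>t. 0 \<le> t \<Longrightarrow> prob {\<omega> \<in> space M. t \<le> Z \<omega>} \<le> 2 * exp (- t\<^sup>2 / (2 * \<sigma>\<^sup>2))"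
    and \<sigma>: "0 < \<sigma>" and \<eta>: "0 \<le> \<eta>" "2 * \<eta> * \<sigma>\<^sup>2 < 1"
  shows "integrable M (\<lambda>\<omega>. exp (\<eta> * (Z \<omega>)\<^sup>2))"
    and "expectation (\<lambda>\<omega>. exp (\<eta> * (Z \<omega>)\<^sup>2)) \<le> 1 + 4 * \<eta> * \<sigma>\<^sup>2 / (1 - 2 * \<eta> * \<sigma>\<^sup>2)"
proof -
  note le = nn_integral_exp_square_le[OF assms]
  have meas: "(\<lambda>\<omega>. exp (\<eta> * (Z \<omega>)\<^sup>2)) \<in> borel_measurable M" using Z by measurable
  show int: "integrable M (\<lambda>\<omega>. exp (\<eta> * (Z \<omega>)\<^sup>2))"
    by (rule integrableI_nonneg) (use meas le in \<open>auto simp: order.strict_trans1[OF _ ennreal_less_top]\<close>)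
  have "ennreal (expectation (\<lambda>\<omega>. exp (\<eta> * (Z \<omega>)\<^sup>2))) = (\<integral>\<^sup>+\<omega>. ennreal (exp (\<eta> * (Z \<omega>)\<^sup>2)) \<partial>M)"
    using int by (intro nn_integral_eq_integral[symmetric]) auto
  with le show "expectation (\<lambda>\<omega>. exp (\<eta> * (Z \<omega>)\<^sup>2)) \<le> 1 + 4 * \<eta> * \<sigma>\<^sup>2 / (1 - 2 * \<eta> * \<sigma>\<^sup>2)"
    using \<sigma> \<eta> by (metis add_nonneg_nonneg diff_ge_0_iff_ge divide_nonneg_nonneg ennreal_le_iff less_eq_real_def mult_nonneg_nonneg zero_le_numeral zero_le_one zero_le_power2)
qed

lemma (in prob_space) subgaussian_tail_integrable_norm:
  fixes W :: "'a \<Rightarrow> real^'n"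
  assumes W[measurable]: "W \<in> borel_measurable M"
    and tail: "\<And>t. 0 \<le> t \<Longrightarrow> prob {\<omega> \<in> space M. t \<le> norm (W \<omega>)} \<le> 2 * exp (- t\<^sup>2 / (2 * \<sigma>\<^sup>2))"
    and \<sigma>: "0 < \<sigma>"
  shows "integrable M W"
proof -
  let ?\<eta> = "1 / (4 * \<sigma>\<^sup>2)"
  have "integrable M (\<lambda>\<omega>. exp (?\<eta> * (norm (W \<omega>))\<^sup>2))"
    using \<sigma> by (intro integrable_exp_square[OF _ _ tail]) auto
  then have "integrable M (\<lambda>\<omega>. 1 + 4 * \<sigma>\<^sup>2 * exp (?\<eta> * (norm (W \<omega>))\<^sup>2))" by simp
  then show ?thesis
  proof (rule Bochner_Integration.integrable_bound)
    show "AE \<omega> in M. norm (W \<omega>) \<le> norm (1 + 4 * \<sigma>\<^sup>2 * exp (?\<eta> * (norm (W \<omega>))\<^sup>2))"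
    proof (rule AE_I2)
      fix \<omega>
      let ?n = "norm (W \<omega>)"
      have "?n \<le> 1 + ?n\<^sup>2" using zero_le_power2[of "?n - 1"] by (simp add: power2_eq_square algebra_simps) (smt (verit) norm_ge_zero)
      also have "?n\<^sup>2 = 4 * \<sigma>\<^sup>2 * (?\<eta> * ?n\<^sup>2)" using \<sigma> by simp
      also have "?\<eta> * ?n\<^sup>2 \<le> exp (?\<eta> * ?n\<^sup>2)" using exp_ge_add_one_self[of "?\<eta> * ?n\<^sup>2"] by linarith
      finally show "?n \<le> norm (1 + 4 * \<sigma>\<^sup>2 * exp (?\<eta> * ?n\<^sup>2))" using \<sigma>
        by (smt (verit) exp_gt_zero mult_nonneg_nonneg mult_left_mono real_norm_def zero_le_power2)
    qed
  qed measurable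
qed

text \<open>With \<open>A = \<sigma>\<^sup>2 * (norm b)\<^sup>2\<close>: for large \<open>A\<close> Young's inequality bounds the exponential by
  \<open>exp (2 * A)\<close> times a variable of mean at most \<open>5 / 3\<close>, and \<open>exp (2 * A)\<close> absorbs this constant.
  For small \<open>A\<close> a constant factor cannot be afforded; there the linear term integrates to \<open>0\<close>
  and only the exponential of the square is left. Both arguments still work at the dividing value
  \<open>A = 3 / 10\<close>.\<close>

lemma (in prob_space) subgaussian_mgf_le:
  fixes W :: "'a \<Rightarrow> real^'n" and b :: "real^'n"
  assumes W[measurable]: "W \<in> borel_measurable M"
    and mean: "\<And>i. expectation (\<lambda>\<omega>. W \<omega> $ i) = 0"
    and tail: "\<And>t. 0 \<le> t \<Longrightarrow> prob {\<omega> \<in> space M. t \<le> norm (W \<omega>)} \<le> 2 * exp (- t\<^sup>2 / (2 * \<sigma>\<^sup>2))"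
    and \<sigma>: "0 < \<sigma>"
  shows "integrable M (\<lambda>\<omega>. exp (b \<bullet> W \<omega>))"
    and "expectation (\<lambda>\<omega>. exp (b \<bullet> W \<omega>)) \<le> exp (4 * \<sigma>\<^sup>2 * (norm b)\<^sup>2)"
proof -
  note exp_square = integrable_exp_square[OF _ _ tail \<sigma>]
  define A where "A = \<sigma>\<^sup>2 * (norm b)\<^sup>2"
  have A0: "0 \<le> A" by (simp add: A_def)
  have cs: "b \<bullet> W \<omega> \<le> norm b * norm (W \<omega>)" "\<bar>b \<bullet> W \<omega>\<bar> \<le> norm b * norm (W \<omega>)" for \<omega>
    by (rule norm_cauchy_schwarz, rule Cauchy_Schwarz_ineq2)
  let ?E = "\<lambda>\<omega>. exp (2 * A) * exp (1 / (8 * \<sigma>\<^sup>2) * (norm (W \<omega>))\<^sup>2)"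
  have young: "exp (b \<bullet> W \<omega>) \<le> ?E \<omega>" for \<omega>
  proof -
    have "0 \<le> (4 * \<sigma>\<^sup>2 * norm b - norm (W \<omega>))\<^sup>2 / (8 * \<sigma>\<^sup>2)" by simp
    also have "\<dots> = 2 * A + 1 / (8 * \<sigma>\<^sup>2) * (norm (W \<omega>))\<^sup>2 - norm b * norm (W \<omega>)"
      using \<sigma> by (simp add: A_def field_simps power2_eq_square)
    finally show ?thesis using cs(1)[of \<omega>] by (simp add: exp_add[symmetric])
  qed
  have i8: "integrable M (\<lambda>\<omega>. exp (1 / (8 * \<sigma>\<^sup>2) * (norm (W \<omega>))\<^sup>2))"
      "expectation (\<lambda>\<omega>. exp (1 / (8 * \<sigma>\<^sup>2) * (norm (W \<omega>))\<^sup>2)) \<le> 5 / 3"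
    using exp_square[of "1 / (8 * \<sigma>\<^sup>2)"] \<sigma> by auto
  show int: "integrable M (\<lambda>\<omega>. exp (b \<bullet> W \<omega>))"
    by (rule Bochner_Integration.integrable_bound[of _ ?E]) (use i8 young in auto)
  show "expectation (\<lambda>\<omega>. exp (b \<bullet> W \<omega>)) \<le> exp (4 * \<sigma>\<^sup>2 * (norm b)\<^sup>2)"
  proof (cases "A \<le> 3 / 10")
    case False
    have "expectation (\<lambda>\<omega>. exp (b \<bullet> W \<omega>)) \<le> expectation ?E"
      using int i8 young by (intro integral_mono) auto
    also have "\<dots> = exp (2 * A) * expectation (\<lambda>\<omega>. exp (1 / (8 * \<sigma>\<^sup>2) * (norm (W \<omega>))\<^sup>2))" by simp
    also have "\<dots> \<le> exp (2 * A) * (5 / 3)" using i8 by (intro mult_left_mono) auto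
    also have "\<dots> \<le> exp (2 * A) * exp (2 * A)"
    proof (rule mult_left_mono)
      have "(3 / 5)\<^sup>2 \<le> (2 * A)\<^sup>2" using False by (intro power_mono) auto
      then show "5 / 3 \<le> exp (2 * A)"
        using exp_lower_Taylor_quadratic[of "2 * A"] A0 False by (simp add: power2_eq_square)
    qed simp
    finally show ?thesis by (simp add: A_def exp_add[symmetric] mult.assoc)
  next
    case True
    let ?\<eta> = "4 / 5 * (norm b)\<^sup>2"
    have \<eta>: "2 * ?\<eta> * \<sigma>\<^sup>2 = 8 / 5 * A" by (simp add: A_def)
    have i: "integrable M (\<lambda>\<omega>. exp (?\<eta> * (norm (W \<omega>))\<^sup>2))"
       and le: "expectation (\<lambda>\<omega>. exp (?\<eta> * (norm (W \<omega>))\<^sup>2)) \<le> 1 + 4 * ?\<eta> * \<sigma>\<^sup>2 / (1 - 2 * ?\<eta> * \<sigma>\<^sup>2)"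
    proof -
      have "2 * ?\<eta> * \<sigma>\<^sup>2 < 1" unfolding \<eta> using True by simp
      then show "integrable M (\<lambda>\<omega>. exp (?\<eta> * (norm (W \<omega>))\<^sup>2))"
        "expectation (\<lambda>\<omega>. exp (?\<eta> * (norm (W \<omega>))\<^sup>2)) \<le> 1 + 4 * ?\<eta> * \<sigma>\<^sup>2 / (1 - 2 * ?\<eta> * \<sigma>\<^sup>2)"
        by (intro exp_square[of ?\<eta>]; simp)+
    qed
    have iW: "integrable M W" by (rule subgaussian_tail_integrable_norm[OF W tail \<sigma>])
    then have ib: "integrable M (\<lambda>\<omega>. b \<bullet> W \<omega>)" by simp
    have "expectation (\<lambda>\<omega>. b \<bullet> W \<omega>) = b \<bullet> expectation W"
      using iW by (intro integral_inner_right) 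
    also have "expectation W = 0"
    proof (rule vec_eq_iff[THEN iffD2], rule allI)
      fix i
      have "expectation W $ i = expectation (\<lambda>\<omega>. W \<omega> $ i)"
        using integral_bounded_linear[OF bounded_linear_vec_nth iW, of i] by simp
      then show "expectation W $ i = 0 $ i" using mean by simp
    qed
    finally have b0: "expectation (\<lambda>\<omega>. b \<bullet> W \<omega>) = 0" by simp
    have "expectation (\<lambda>\<omega>. exp (b \<bullet> W \<omega>)) \<le> expectation (\<lambda>\<omega>. b \<bullet> W \<omega> + exp (?\<eta> * (norm (W \<omega>))\<^sup>2))"
    proof (intro integral_mono int)
      fix \<omega>
      have "(b \<bullet> W \<omega>)\<^sup>2 \<le> (norm b * norm (W \<omega>))\<^sup>2"
        using cs(2)[of \<omega>] by (metis abs_ge_zero power2_abs power_mono)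
      then have "4 / 5 * (b \<bullet> W \<omega>)\<^sup>2 \<le> ?\<eta> * (norm (W \<omega>))\<^sup>2" by (simp add: power_mult_distrib)
      then have "exp (4 / 5 * (b \<bullet> W \<omega>)\<^sup>2) \<le> exp (?\<eta> * (norm (W \<omega>))\<^sup>2)" by (rule exp_mono)
      then show "exp (b \<bullet> W \<omega>) \<le> b \<bullet> W \<omega> + exp (?\<eta> * (norm (W \<omega>))\<^sup>2)"
        using exp_le_linear_plus_exp_square[of "b \<bullet> W \<omega>"] by linarith
    qed (use ib i in auto)
    also have "\<dots> = expectation (\<lambda>\<omega>. exp (?\<eta> * (norm (W \<omega>))\<^sup>2))"
      using ib i b0 by simp
    also note le
    also have "1 + 4 * ?\<eta> * \<sigma>\<^sup>2 / (1 - 2 * ?\<eta> * \<sigma>\<^sup>2) = 1 + 16 / 5 * A / (1 - 8 / 5 * A)"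
      unfolding \<eta> by (simp add: A_def)
    also have "\<dots> \<le> 1 + 4 * A + (4 * A)\<^sup>2 / 2"
    proof -
      have "0 \<le> A * (4 / 5 + 8 / 5 * A - 64 / 5 * A\<^sup>2)"
      proof (rule mult_nonneg_nonneg[OF A0])
        have "A * A \<le> 3 / 10 * A" using True A0 by (rule mult_right_mono)
        then show "0 \<le> 4 / 5 + 8 / 5 * A - 64 / 5 * A\<^sup>2" using True by (simp add: power2_eq_square)
      qed
      also have "\<dots> = (4 * A + (4 * A)\<^sup>2 / 2) * (1 - 8 / 5 * A) - 16 / 5 * A"
        by (simp add: power2_eq_square algebra_simps)
      finally have "16 / 5 * A \<le> (4 * A + (4 * A)\<^sup>2 / 2) * (1 - 8 / 5 * A)" by simp
      then have "16 / 5 * A / (1 - 8 / 5 * A) \<le> 4 * A + (4 * A)\<^sup>2 / 2"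
        using True by (subst pos_divide_le_eq) auto
      then show ?thesis by simp
    qed
    also have "\<dots> \<le> exp (4 * A)" using A0 by (intro exp_lower_Taylor_quadratic) simp
    finally show ?thesis by (simp add: A_def mult.assoc)
  qed
qed

text \<open>The linear and the quadratic part are separated as in the Cauchy--Schwarz inequality. That
  inequality is replaced by \<open>2 * s * t \<le> s\<^sup>2 + t\<^sup>2\<close> with the weights that are optimal for the
  bounds \<open>exp ?u\<close> and \<open>exp ?v\<close> of the two separate moments.\<close>

lemma (in prob_space) subgaussian_quadratic_mgf_le:
  fixes W :: "'a \<Rightarrow> real^'n" and b :: "real^'n"
  assumes W[measurable]: "W \<in> borel_measurable M"
    and mean: "\<And>i. expectation (\<lambda>\<omega>. W \<omega> $ i) = 0"
    and tail: "\<And>t. 0 \<le> t \<Longrightarrow> prob {\<omega> \<in> space M. t \<le> norm (W \<omega>)} \<le> 2 * exp (- t\<^sup>2 / (2 * \<sigma>\<^sup>2))"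
    and \<sigma>: "0 < \<sigma>" and \<zeta>: "0 \<le> \<zeta>" "16 * \<zeta> * \<sigma>\<^sup>2 \<le> 1"
  shows "(\<integral>\<^sup>+\<omega>. ennreal (exp (b \<bullet> W \<omega> + \<zeta> * (norm (W \<omega>))\<^sup>2)) \<partial>M)
      \<le> ennreal (exp (8 * \<sigma>\<^sup>2 * (norm b)\<^sup>2 + 16 / 3 * \<zeta> * \<sigma>\<^sup>2))"
proof -
  let ?u = "16 * \<sigma>\<^sup>2 * (norm b)\<^sup>2" and ?v = "32 / 3 * \<zeta> * \<sigma>\<^sup>2"
  let ?F = "\<lambda>\<omega>. exp ((2 *\<^sub>R b) \<bullet> W \<omega>)" and ?G = "\<lambda>\<omega>. exp (2 * \<zeta> * (norm (W \<omega>))\<^sup>2)"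
  let ?H = "\<lambda>\<omega>. (exp ((?v - ?u) / 2) * ?F \<omega> + exp ((?u - ?v) / 2) * ?G \<omega>) / 2"
  have F: "integrable M ?F" "expectation ?F \<le> exp ?u"
    using subgaussian_mgf_le[OF W mean tail \<sigma>, of "2 *\<^sub>R b"] by (auto simp: power_mult_distrib mult.assoc)
  have G: "integrable M ?G" "expectation ?G \<le> 1 + 4 * (2 * \<zeta>) * \<sigma>\<^sup>2 / (1 - 2 * (2 * \<zeta>) * \<sigma>\<^sup>2)"
    using \<zeta> by (intro integrable_exp_square[OF _ _ tail \<sigma>]; simp)+
  note G(2)
  also have "1 + 4 * (2 * \<zeta>) * \<sigma>\<^sup>2 / (1 - 2 * (2 * \<zeta>) * \<sigma>\<^sup>2) \<le> 1 + ?v"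
  proof -
    have "0 \<le> \<zeta> * \<sigma>\<^sup>2" using \<zeta> by simp
    then have "8 * (\<zeta> * \<sigma>\<^sup>2) \<le> 32 / 3 * (\<zeta> * \<sigma>\<^sup>2) * (1 - 4 * (\<zeta> * \<sigma>\<^sup>2))"
      using \<zeta> mult_left_mono[of "\<zeta> * \<sigma>\<^sup>2" "1 / 16" "\<zeta> * \<sigma>\<^sup>2"] by (simp add: algebra_simps)
    then show ?thesis using \<zeta> by (simp add: pos_divide_le_eq algebra_simps)
  qed
  also have "\<dots> \<le> exp ?v" by (rule exp_ge_add_one_self)
  finally have G': "expectation ?G \<le> exp ?v" .
  have "exp (b \<bullet> W \<omega> + \<zeta> * (norm (W \<omega>))\<^sup>2) \<le> ?H \<omega>" for \<omega>
  proof -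
    define s where "s = exp ((?v - ?u) / 4 + b \<bullet> W \<omega>)"
    define t where "t = exp ((?u - ?v) / 4 + \<zeta> * (norm (W \<omega>))\<^sup>2)"
    have "s * t = exp (b \<bullet> W \<omega> + \<zeta> * (norm (W \<omega>))\<^sup>2)"
      by (simp add: s_def t_def exp_add[symmetric] field_simps)
    moreover have "s\<^sup>2 = exp ((?v - ?u) / 2) * ?F \<omega>" "t\<^sup>2 = exp ((?u - ?v) / 2) * ?G \<omega>"
      by (simp_all add: s_def t_def power2_eq_square exp_add[symmetric] field_simps)
    moreover have "2 * s * t \<le> s\<^sup>2 + t\<^sup>2" by (rule sum_squares_bound)
    ultimately show ?thesis by simp
  qed
  then have "(\<integral>\<^sup>+\<omega>. ennreal (exp (b \<bullet> W \<omega> + \<zeta> * (norm (W \<omega>))\<^sup>2)) \<partial>M) \<le> (\<integral>\<^sup>+\<omega>. ennreal (?H \<omega>) \<partial>M)"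
    by (intro nn_integral_mono ennreal_leI)
  also have "\<dots> = ennreal (expectation ?H)"
    using F G by (intro nn_integral_eq_integral) auto
  also have "expectation ?H = (exp ((?v - ?u) / 2) * expectation ?F + exp ((?u - ?v) / 2) * expectation ?G) / 2"
    using F G by simp
  also have "ennreal \<dots> \<le> ennreal ((exp ((?v - ?u) / 2) * exp ?u + exp ((?u - ?v) / 2) * exp ?v) / 2)"
    using F G' by (intro ennreal_leI divide_right_mono add_mono mult_left_mono) auto
  also have "(exp ((?v - ?u) / 2) * exp ?u + exp ((?u - ?v) / 2) * exp ?v) / 2 = exp ((?u + ?v) / 2)"
  proof -
    have "(?v - ?u) / 2 + ?u = (?u + ?v) / 2" "(?u - ?v) / 2 + ?v = (?u + ?v) / 2" by (simp_all add: field_simps)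
    moreover have "(e + e) / 2 = e" for e :: real by simp
    ultimately show ?thesis by (simp only: exp_add[symmetric])
  qed
  also have "(?u + ?v) / 2 = 8 * \<sigma>\<^sup>2 * (norm b)\<^sup>2 + 16 / 3 * \<zeta> * \<sigma>\<^sup>2" by simp
  finally show ?thesis .
qed

section \<open>Independence of noise and state\<close>

text \<open>Independence of the two families of preimages says that the joint distribution of \<open>X\<close> and
  \<open>Y\<close> is the product of their distributions; Tonelli's theorem does the rest. It allows \<open>Y\<close> to be
  integrated out with \<open>X\<close> frozen.\<close>

lemma (in prob_space) indep_set_nn_integral_iterated:
  assumes X[measurable]: "X \<in> measurable M S" and Y[measurable]: "Y \<in> measurable M T"
    and indep: "indep_set {X -` A \<inter> space M | A. A \<in> sets S} {Y -` B \<inter> space M | B. B \<in> sets T}"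
    and h: "h \<in> borel_measurable (S \<Otimes>\<^sub>M T)"
  shows "(\<integral>\<^sup>+\<omega>. h (X \<omega>, Y \<omega>) \<partial>M) = (\<integral>\<^sup>+\<omega>. (\<integral>\<^sup>+\<omega>'. h (X \<omega>, Y \<omega>') \<partial>M) \<partial>M)"
proof -
  interpret X: prob_space "distr M S X" by (rule prob_space_distr) simp
  interpret Y: prob_space "distr M T Y" by (rule prob_space_distr) simp
  have prod: "distr M S X \<Otimes>\<^sub>M distr M T Y = distr M (S \<Otimes>\<^sub>M T) (\<lambda>x. (X x, Y x))"
  proof (rule pair_measure_eqI)
    fix A B assume "A \<in> sets (distr M S X)" "B \<in> sets (distr M T Y)"
    then have AB[measurable]: "A \<in> sets S" "B \<in> sets T" by auto
    have "(\<lambda>x. (X x, Y x)) -` (A \<times> B) \<inter> space M = (X -` A \<inter> space M) \<inter> (Y -` B \<inter> space M)" by auto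
    moreover have "prob ((X -` A \<inter> space M) \<inter> (Y -` B \<inter> space M)) = prob (X -` A \<inter> space M) * prob (Y -` B \<inter> space M)"
      using AB by (intro indep_setD[OF indep]) auto
    ultimately show "emeasure (distr M S X) A * emeasure (distr M T Y) B
        = emeasure (distr M (S \<Otimes>\<^sub>M T) (\<lambda>x. (X x, Y x))) (A \<times> B)"
      by (simp add: emeasure_distr emeasure_eq_measure ennreal_mult)
  qed (auto simp: X.sigma_finite_measure_axioms Y.sigma_finite_measure_axioms)
  note h[measurable]
  have "(\<integral>\<^sup>+\<omega>. h (X \<omega>, Y \<omega>) \<partial>M) = (\<integral>\<^sup>+z. h z \<partial>distr M (S \<Otimes>\<^sub>M T) (\<lambda>x. (X x, Y x)))"
    by (simp add: nn_integral_distr)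
  also have "\<dots> = (\<integral>\<^sup>+z. h z \<partial>(distr M S X \<Otimes>\<^sub>M distr M T Y))" by (simp add: prod)
  also have "\<dots> = (\<integral>\<^sup>+x. \<integral>\<^sup>+y. h (x, y) \<partial>distr M T Y \<partial>distr M S X)"
    by (rule Y.nn_integral_fst[symmetric]) simp
  also have "\<dots> = (\<integral>\<^sup>+\<omega>. \<integral>\<^sup>+y. h (X \<omega>, y) \<partial>distr M T Y \<partial>M)"
    by (rule nn_integral_distr) (auto intro!: Y.borel_measurable_nn_integral)
  also have "\<dots> = (\<integral>\<^sup>+\<omega>. (\<integral>\<^sup>+\<omega>'. h (X \<omega>, Y \<omega>') \<partial>M) \<partial>M)"
    by (intro nn_integral_cong nn_integral_distr) (auto intro: measurable_compose[OF measurable_Pair1'])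
  finally show ?thesis .
qed

lemma measurable_natural_filtration:
  fixes X :: "nat \<Rightarrow> 'w \<Rightarrow> real^'n"
  assumes "i \<le> k"
  shows "X i \<in> borel_measurable (natural_filtration M X k)"
proof (rule measurableI)
  fix A :: "(real^'n) set" assume "A \<in> sets borel"
  then have "X i -` A \<inter> space M \<in> (\<Union>i\<le>k. {X i -` A \<inter> space M | A. A \<in> sets borel})"
    using assms by blast
  moreover have "(\<Union>i\<le>k. {X i -` A \<inter> space M | A. A \<in> sets borel}) \<subseteq> Pow (space M)" by blast
  ultimately show "X i -` A \<inter> space (natural_filtration M X k) \<in> sets (natural_filtration M X k)"
    unfolding natural_filtration_def space_measure_of_conv by (intro in_measure_of)
qed simp

lemma subalgebra_natural_filtration:
  assumes "\<And>i. i \<le> k \<Longrightarrow> X i \<in> borel_measurable M"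
  shows "subalgebra M (natural_filtration M X k)"
proof -
  let ?G = "\<Union>i\<le>k. {X i -` A \<inter> space M | A. A \<in> sets borel}"
  have "?G \<subseteq> sets M" using assms by (auto intro: measurable_sets)
  then have "sigma_sets (space M) ?G \<subseteq> sets M" by (rule sets.sigma_sets_subset)
  moreover have "sets (natural_filtration M X k) = sigma_sets (space M) ?G"
    unfolding natural_filtration_def by (rule sets_measure_of) blast
  moreover have "space (natural_filtration M X k) = space M"
    unfolding natural_filtration_def by (rule space_measure_of_conv)
  ultimately show ?thesis unfolding subalgebra_def by simp
qed

lemma borel_measurable_gmm_state:
  fixes f :: "real^'n \<Rightarrow> real"
  assumes g[measurable]: "grad f \<in> borel_measurable borel"
    and w: "\<And>k. w (Suc k) \<in> borel_measurable M"
  shows "(\<lambda>\<omega>. fst (gmm_state f \<alpha> \<beta> \<gamma> x0 xm1 (\<lambda>j. w j \<omega>) k)) \<in> borel_measurable M"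
    and "(\<lambda>\<omega>. snd (gmm_state f \<alpha> \<beta> \<gamma> x0 xm1 (\<lambda>j. w j \<omega>) k)) \<in> borel_measurable M"
proof (induction k)
  case (Suc k)
  note Suc[measurable] w[measurable]
  { case 1 show ?case by (simp add: Let_def split_beta) }
  { case 2 show ?case by (simp add: Let_def split_beta) }
qed simp_all

lemma snd_gmm_state:
  "snd (gmm_state f \<alpha> \<beta> \<gamma> x0 xm1 w' k) = (case k of 0 \<Rightarrow> xm1 | Suc j \<Rightarrow> fst (gmm_state f \<alpha> \<beta> \<gamma> x0 xm1 w' j))"
  by (cases k) (simp_all add: Let_def split_beta)

text \<open>The conditional statements of the noise model integrate to unconditional ones. Since both blocks
  of the \<open>k\<close>-th state are among the iterates up to time \<open>k\<close> or deterministic, the next noise vector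
  is independent of the state.\<close>

lemma (in prob_space) subgaussian_noise_unconditional:
  fixes f :: "real^'n \<Rightarrow> real"
  assumes noise: "subgaussian_noise M (gmm f \<alpha> \<beta> \<gamma> x0 xm1 w) w \<sigma>" and \<sigma>: "0 < \<sigma>"
    and g: "grad f \<in> borel_measurable borel"
  shows "w (Suc k) \<in> borel_measurable M"
    and "expectation (\<lambda>\<omega>. w (Suc k) \<omega> $ i) = 0"
    and "0 \<le> t \<Longrightarrow> prob {\<omega> \<in> space M. t \<le> norm (w (Suc k) \<omega>)} \<le> 2 * exp (- t\<^sup>2 / (2 * \<sigma>\<^sup>2))"
    and "indep_set {(\<lambda>\<omega>. gmm_state f \<alpha> \<beta> \<gamma> x0 xm1 (\<lambda>j. w j \<omega>) k) -` A \<inter> space M | A. A \<in> sets borel}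
        {w (Suc k) -` B \<inter> space M | B. B \<in> sets borel}"
proof -
  define X where "X = gmm f \<alpha> \<beta> \<gamma> x0 xm1 w"
  define F where "F = natural_filtration M X k"
  have w: "w (Suc k) \<in> borel_measurable M" for k
    using noise unfolding subgaussian_noise_def by blast
  then show "w (Suc k) \<in> borel_measurable M" .
  note w[measurable]
  have X: "X i \<in> borel_measurable M" for i
    unfolding X_def gmm_def by (intro borel_measurable_gmm_state g w)
  have sub: "subalgebra M F"
    unfolding F_def by (rule subalgebra_natural_filtration[OF X])
  interpret finite_measure_subalgebra M F
    by standard (rule sub)
  have tail: "prob {\<omega> \<in> space M. t \<le> norm (w (Suc k) \<omega>)} \<le> 2 * exp (- t\<^sup>2 / (2 * \<sigma>\<^sup>2))" if "0 \<le> t" for t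
  proof -
    let ?I = "indicator {\<omega> \<in> space M. t \<le> norm (w (Suc k) \<omega>)} :: 'a \<Rightarrow> real"
    have int: "integrable M ?I" by (intro integrable_real_indicator) (auto simp: less_top[symmetric])
    have "prob {\<omega> \<in> space M. t \<le> norm (w (Suc k) \<omega>)} = expectation ?I" by simp
    also have "\<dots> = expectation (real_cond_exp M F ?I)"
      using real_cond_exp_int(2)[OF int] by simp
    also have "\<dots> \<le> expectation (\<lambda>_. 2 * exp (- t\<^sup>2 / (2 * \<sigma>\<^sup>2)))"
      using noise that real_cond_exp_int(1)[OF int]
      unfolding subgaussian_noise_def F_def X_def by (intro integral_mono_AE) auto
    finally show ?thesis by (simp add: prob_space)
  qed
  then show "0 \<le> t \<Longrightarrow> prob {\<omega> \<in> space M. t \<le> norm (w (Suc k) \<omega>)} \<le> 2 * exp (- t\<^sup>2 / (2 * \<sigma>\<^sup>2))" .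
  show "expectation (\<lambda>\<omega>. w (Suc k) \<omega> $ i) = 0"
  proof -
    have "integrable M (w (Suc k))" by (rule subgaussian_tail_integrable_norm[OF _ tail \<sigma>]) simp
    then have "integrable M (\<lambda>\<omega>. w (Suc k) \<omega> $ i)"
      by (rule integrable_bounded_linear[OF bounded_linear_vec_nth])
    then have "expectation (\<lambda>\<omega>. w (Suc k) \<omega> $ i) = expectation (real_cond_exp M F (\<lambda>\<omega>. w (Suc k) \<omega> $ i))"
      using real_cond_exp_int(2) by metis
    also have "\<dots> = expectation (\<lambda>_. 0)"
      using noise unfolding subgaussian_noise_def F_def X_def by (intro integral_cong_AE) auto
    finally show ?thesis by simp
  qed
  show "indep_set {(\<lambda>\<omega>. gmm_state f \<alpha> \<beta> \<gamma> x0 xm1 (\<lambda>j. w j \<omega>) k) -` A \<inter> space M | A. A \<in> sets borel}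
        {w (Suc k) -` B \<inter> space M | B. B \<in> sets borel}"
  proof -
    let ?S = "\<lambda>\<omega>. gmm_state f \<alpha> \<beta> \<gamma> x0 xm1 (\<lambda>j. w j \<omega>) k"
    have "(\<lambda>\<omega>. fst (?S \<omega>)) \<in> borel_measurable F"
      using measurable_natural_filtration[of k k X M] unfolding F_def X_def gmm_def by simp
    moreover have "(\<lambda>\<omega>. snd (?S \<omega>)) \<in> borel_measurable F"
      using measurable_natural_filtration[of "k - 1" k X M]
      by (cases k) (simp_all add: F_def X_def gmm_def[abs_def] snd_gmm_state del: gmm_state.simps)
    ultimately have "(\<lambda>\<omega>. (fst (?S \<omega>), snd (?S \<omega>))) \<in> borel_measurable F"
      by (rule borel_measurable_Pair)
    then have S: "?S \<in> borel_measurable F" by simp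
    have spF: "space F = space M" using sub by (simp add: subalgebra_def)
    have sub_F: "{?S -` A \<inter> space M |A. A \<in> sets borel} \<subseteq> sets F"
      using measurable_sets[OF S] by (auto simp: spF)
    have indep: "indep_set {w (Suc k) -` A \<inter> space M |A. A \<in> sets borel} (sets F)"
      using noise unfolding subgaussian_noise_def F_def X_def by blast
    show ?thesis
      unfolding indep_sets2_eq
    proof (intro conjI ballI)
      fix a b
      assume "a \<in> {?S -` A \<inter> space M | A. A \<in> sets borel}"
        and b: "b \<in> {w (Suc k) -` B \<inter> space M | B. B \<in> sets borel}"
      then have "a \<in> sets F" using sub_F by blast
      from indep_setD[OF indep b this] show "prob (a \<inter> b) = prob a * prob b"
        by (metis Int_commute mult.commute)
    qed (use sub_F indep_setD_ev1[OF indep] indep_setD_ev2[OF indep] in blast)+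
  qed
qed

section \<open>Exponential moments of the energy\<close>

text \<open>One step costs a factor \<open>q\<close> in the exponent, so the bound for \<open>\<tau>\<close> at time \<open>Suc k\<close> comes from
  the bound for \<open>\<tau> * q\<close> at time \<open>k\<close>. As \<open>q \<le> 1\<close>, the exponent never leaves the range
  \<open>{0..T}\<close> in which the step is valid.\<close>

lemma (in prob_space) mgf_recursion:
  fixes V :: "nat \<Rightarrow> 'a \<Rightarrow> real"
  assumes q: "0 \<le> q" "q \<le> 1" and init: "\<And>\<omega>. V 0 \<omega> = v"
    and step: "\<And>k \<tau>. 0 \<le> \<tau> \<Longrightarrow> \<tau> \<le> T \<Longrightarrow>
      (\<integral>\<^sup>+\<omega>. ennreal (exp (\<tau> * V (Suc k) \<omega>)) \<partial>M) \<le> (\<integral>\<^sup>+\<omega>. ennreal (exp (\<tau> * (q * V k \<omega> + c))) \<partial>M)"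
    and meas: "\<And>k. V k \<in> borel_measurable M"
    and \<tau>: "0 \<le> \<tau>" "\<tau> \<le> T"
  shows "(\<integral>\<^sup>+\<omega>. ennreal (exp (\<tau> * V k \<omega>)) \<partial>M) \<le> ennreal (exp (\<tau> * (q ^ k * v + c * (\<Sum>i<k. q ^ i))))"
  using \<tau>
proof (induction k arbitrary: \<tau>)
  case 0
  then show ?case by (simp add: init emeasure_space_1)
next
  case (Suc k)
  have \<tau>q: "0 \<le> \<tau> * q" "\<tau> * q \<le> T" using Suc.prems q mult_left_le[of q \<tau>] by auto
  have "(\<integral>\<^sup>+\<omega>. ennreal (exp (\<tau> * V (Suc k) \<omega>)) \<partial>M) \<le> (\<integral>\<^sup>+\<omega>. ennreal (exp (\<tau> * (q * V k \<omega> + c))) \<partial>M)"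
    by (rule step[OF Suc.prems])
  also have "\<dots> = (\<integral>\<^sup>+\<omega>. ennreal (exp (\<tau> * c)) * ennreal (exp ((\<tau> * q) * V k \<omega>)) \<partial>M)"
    by (simp add: ennreal_mult[symmetric] exp_add[symmetric] algebra_simps)
  also have "\<dots> = ennreal (exp (\<tau> * c)) * (\<integral>\<^sup>+\<omega>. ennreal (exp ((\<tau> * q) * V k \<omega>)) \<partial>M)"
    using meas[of k] by (intro nn_integral_cmult) measurable
  also have "\<dots> \<le> ennreal (exp (\<tau> * c)) * ennreal (exp ((\<tau> * q) * (q ^ k * v + c * (\<Sum>i<k. q ^ i))))"
    by (intro mult_left_mono Suc.IH \<tau>q) simp
  also have "\<dots> = ennreal (exp (\<tau> * c + (\<tau> * q) * (q ^ k * v + c * (\<Sum>i<k. q ^ i))))"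
    by (simp add: ennreal_mult[symmetric] exp_add)
  also have "(\<Sum>i<Suc k. q ^ i) = 1 + q * (\<Sum>i<k. q ^ i)"
    unfolding sum.lessThan_Suc_shift by (simp add: sum_distrib_left)
  then have "\<tau> * c + (\<tau> * q) * (q ^ k * v + c * (\<Sum>i<k. q ^ i)) = \<tau> * (q ^ Suc k * v + c * (\<Sum>i<Suc k. q ^ i))"
    by (simp add: algebra_simps)
  finally show ?case .
qed

text \<open>The noise contributes \<open>- \<tau> * \<alpha> * (G \<bullet> W)\<close> and a multiple of \<open>(norm W)\<^sup>2\<close> to the exponent,
  where \<open>G\<close> is the gradient of the energy at the noiseless iterate. The logarithm of the
  exponential moment of the first is of order \<open>\<tau>\<^sup>2 * (norm G)\<^sup>2\<close>; one factor \<open>\<tau>\<close> is traded for \<open>\<theta>\<close>, and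
  \<open>(norm G)\<^sup>2\<close> is bounded by the energy itself, so this part worsens the contraction rate. The
  second part is the additive constant.\<close>

lemma (in prob_space) energy_mgf_step:
  fixes f :: "real^'n \<Rightarrow> real" and W :: "'a \<Rightarrow> real^'n"
  assumes f: "smooth L f" "0 < L" "\<And>y. f xs \<le> f y" and p: "0 < p"
    and W[measurable]: "W \<in> borel_measurable M"
    and mean: "\<And>i. expectation (\<lambda>\<omega>. W \<omega> $ i) = 0"
    and tail: "\<And>t. 0 \<le> t \<Longrightarrow> prob {\<omega> \<in> space M. t \<le> norm (W \<omega>)} \<le> 2 * exp (- t\<^sup>2 / (2 * \<sigma>\<^sup>2))"
    and \<sigma>: "0 < \<sigma>"
    and contraction: "energy f xs p m xb x \<le> \<rho> * V" and V: "0 \<le> V"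
    and v: "(2 * L + 4 * p\<^sup>2) * \<rho> \<le> 16 * v"
    and \<tau>: "0 \<le> \<tau>" "2 * \<sigma>\<^sup>2 * \<tau> \<le> \<theta>" and \<theta>: "4 * \<theta> * \<alpha>\<^sup>2 * (L + 2 * p\<^sup>2) \<le> 1"
  shows "(\<integral>\<^sup>+\<omega>. ennreal (exp (\<tau> * energy f xs p m (xb - \<alpha> *\<^sub>R W \<omega>) x)) \<partial>M)
    \<le> ennreal (exp (\<tau> * ((\<rho> + 64 * \<alpha>\<^sup>2 * v * \<theta>) * V + 8 / 3 * \<sigma>\<^sup>2 * \<alpha>\<^sup>2 * (L + 2 * p\<^sup>2))))"
proof -
  define G where "G = grad f xb + (2 * p) *\<^sub>R (p *\<^sub>R (xb - xs) + (m - p) *\<^sub>R (x - xs))"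
  define b where "b = (- \<tau> * \<alpha>) *\<^sub>R G"
  define \<zeta> where "\<zeta> = \<tau> * \<alpha>\<^sup>2 * (L / 2 + p\<^sup>2)"
  have \<zeta>: "0 \<le> \<zeta>" using \<tau> f by (simp add: \<zeta>_def)
  have "16 * \<zeta> * \<sigma>\<^sup>2 \<le> 1"
  proof -
    have "16 * \<zeta> * \<sigma>\<^sup>2 = 2 * \<sigma>\<^sup>2 * \<tau> * (4 * \<alpha>\<^sup>2 * (L + 2 * p\<^sup>2))" by (simp add: \<zeta>_def algebra_simps)
    also have "\<dots> \<le> \<theta> * (4 * \<alpha>\<^sup>2 * (L + 2 * p\<^sup>2))" using \<tau> f by (intro mult_right_mono) auto
    finally show ?thesis using \<theta> by (simp add: algebra_simps)
  qed
  have G: "(norm G)\<^sup>2 \<le> 16 * v * V"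
  proof -
    have "(norm G)\<^sup>2 \<le> (2 * L + 4 * p\<^sup>2) * energy f xs p m xb x"
      unfolding G_def using f p by (intro energy_grad_bound)
    also have "\<dots> \<le> (2 * L + 4 * p\<^sup>2) * (\<rho> * V)" using contraction f by (intro mult_left_mono) auto
    also have "\<dots> \<le> 16 * v * V" using mult_right_mono[OF v V] by (simp add: mult.assoc)
    finally show ?thesis .
  qed
  have b: "8 * \<sigma>\<^sup>2 * (norm b)\<^sup>2 \<le> \<tau> * (64 * \<alpha>\<^sup>2 * v * \<theta> * V)"
  proof -
    have "8 * \<sigma>\<^sup>2 * (norm b)\<^sup>2 = 2 * \<sigma>\<^sup>2 * \<tau> * (4 * \<tau> * \<alpha>\<^sup>2 * (norm G)\<^sup>2)"
      by (simp add: b_def power_mult_distrib) (simp add: power2_eq_square)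
    also have "\<dots> \<le> \<theta> * (4 * \<tau> * \<alpha>\<^sup>2 * (norm G)\<^sup>2)" using \<tau> by (intro mult_right_mono) auto
    also have "\<dots> \<le> \<theta> * (4 * \<tau> * \<alpha>\<^sup>2 * (16 * v * V))"
    proof -
      have "0 \<le> 2 * \<sigma>\<^sup>2 * \<tau>" using \<tau>(1) by simp
      then have "0 \<le> \<theta>" using \<tau>(2) by (rule order_trans)
      then show ?thesis using G \<tau> by (intro mult_left_mono) auto
    qed
    finally show ?thesis by (simp add: algebra_simps)
  qed
  have "\<tau> * energy f xs p m (xb - \<alpha> *\<^sub>R W \<omega>) x \<le> \<tau> * (\<rho> * V) + (b \<bullet> W \<omega> + \<zeta> * (norm (W \<omega>))\<^sup>2)" for \<omega>
  proof -
    have "energy f xs p m (xb - \<alpha> *\<^sub>R W \<omega>) x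
        \<le> \<rho> * V - \<alpha> * (G \<bullet> W \<omega>) + \<alpha>\<^sup>2 * (L / 2 + p\<^sup>2) * (norm (W \<omega>))\<^sup>2"
      using energy_noisy_step[OF f(1), of xs p m xb \<alpha> "W \<omega>" x] contraction unfolding G_def by linarith
    from mult_left_mono[OF this \<tau>(1)] show ?thesis
      by (simp add: b_def \<zeta>_def algebra_simps)
  qed
  then have "(\<integral>\<^sup>+\<omega>. ennreal (exp (\<tau> * energy f xs p m (xb - \<alpha> *\<^sub>R W \<omega>) x)) \<partial>M)
      \<le> (\<integral>\<^sup>+\<omega>. ennreal (exp (\<tau> * (\<rho> * V))) * ennreal (exp (b \<bullet> W \<omega> + \<zeta> * (norm (W \<omega>))\<^sup>2)) \<partial>M)"
    by (intro nn_integral_mono) (simp add: ennreal_mult[symmetric] exp_add[symmetric])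
  also have "\<dots> = ennreal (exp (\<tau> * (\<rho> * V))) * (\<integral>\<^sup>+\<omega>. ennreal (exp (b \<bullet> W \<omega> + \<zeta> * (norm (W \<omega>))\<^sup>2)) \<partial>M)"
    by (intro nn_integral_cmult) measurable
  also have "\<dots> \<le> ennreal (exp (\<tau> * (\<rho> * V))) * ennreal (exp (8 * \<sigma>\<^sup>2 * (norm b)\<^sup>2 + 16 / 3 * \<zeta> * \<sigma>\<^sup>2))"
    by (intro mult_left_mono subgaussian_quadratic_mgf_le[OF W mean tail \<sigma> \<zeta>] \<open>16 * \<zeta> * \<sigma>\<^sup>2 \<le> 1\<close>) auto
  also have "\<dots> = ennreal (exp (\<tau> * (\<rho> * V) + (8 * \<sigma>\<^sup>2 * (norm b)\<^sup>2 + 16 / 3 * \<zeta> * \<sigma>\<^sup>2)))"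
    by (simp add: ennreal_mult[symmetric] exp_add)
  also have "\<dots> \<le> ennreal (exp (\<tau> * ((\<rho> + 64 * \<alpha>\<^sup>2 * v * \<theta>) * V + 8 / 3 * \<sigma>\<^sup>2 * \<alpha>\<^sup>2 * (L + 2 * p\<^sup>2))))"
  proof (intro ennreal_leI exp_mono)
    have "16 / 3 * \<zeta> * \<sigma>\<^sup>2 = \<tau> * (8 / 3 * \<sigma>\<^sup>2 * \<alpha>\<^sup>2 * (L + 2 * p\<^sup>2))" by (simp add: \<zeta>_def field_simps)
    with b have "8 * \<sigma>\<^sup>2 * (norm b)\<^sup>2 + 16 / 3 * \<zeta> * \<sigma>\<^sup>2
        \<le> \<tau> * (64 * \<alpha>\<^sup>2 * v * \<theta> * V) + \<tau> * (8 / 3 * \<sigma>\<^sup>2 * \<alpha>\<^sup>2 * (L + 2 * p\<^sup>2))" by linarith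
    then show "\<tau> * (\<rho> * V) + (8 * \<sigma>\<^sup>2 * (norm b)\<^sup>2 + 16 / 3 * \<zeta> * \<sigma>\<^sup>2)
        \<le> \<tau> * ((\<rho> + 64 * \<alpha>\<^sup>2 * v * \<theta>) * V + 8 / 3 * \<sigma>\<^sup>2 * \<alpha>\<^sup>2 * (L + 2 * p\<^sup>2))"
      by (simp only: distrib_left distrib_right)
  qed
  finally show ?thesis .
qed

section \<open>The entropic risk\<close>

text \<open>The number \<open>x\<close> is the larger root of \<open>x\<^sup>2 = (\<rho> + B) * x + B\<close>. Hence
  \<open>x = \<rho> + B + B / x\<close> for positive \<open>x\<close>, and \<open>x < 1\<close> makes the last summand at least \<open>B\<close>.\<close>

lemma rate_bounds:
  fixes \<rho> B :: real
  assumes \<rho>: "0 \<le> \<rho>" and B: "0 \<le> B" "2 * B < 1 - \<rho>"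
    and x: "x = 1 / 2 * (\<rho> + B) + 1 / 2 * sqrt ((\<rho> + B)\<^sup>2 + 4 * B)"
  shows "\<rho> + 2 * B \<le> x" "x < 1"
proof -
  define S where "S = sqrt ((\<rho> + B)\<^sup>2 + 4 * B)"
  have x': "x = (\<rho> + B + S) / 2" by (simp add: x S_def)
  have "\<rho> + 3 * B \<le> S"
    unfolding S_def
  proof (rule real_le_rsqrt)
    have "0 \<le> 4 * B * (1 - \<rho> - 2 * B)" using B by simp
    then show "(\<rho> + 3 * B)\<^sup>2 \<le> (\<rho> + B)\<^sup>2 + 4 * B" by (simp add: power2_eq_square algebra_simps)
  qed
  then show "\<rho> + 2 * B \<le> x" by (simp add: x')
  have "S < 2 - (\<rho> + B)"
    unfolding S_def using \<rho> B by (intro real_less_lsqrt) (auto simp: power2_eq_square algebra_simps)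
  then show "x < 1" by (simp add: x')
qed

lemma entropic_risk_less:
  assumes M: "prob_space M" and Y: "Y \<in> borel_measurable M" and \<sigma>: "0 < \<sigma>" and \<theta>: "0 < \<theta>"
    and le: "(\<integral>\<^sup>+\<omega>. ennreal (exp (\<theta> / (2 * \<sigma>\<^sup>2) * Y \<omega>)) \<partial>M) \<le> ennreal (exp (\<theta> / (2 * \<sigma>\<^sup>2) * a))"
    and "a < c"
  shows "entropic_risk M \<sigma> \<theta> Y < ereal c"
proof -
  interpret prob_space M by fact
  let ?s = "\<theta> / (2 * \<sigma>\<^sup>2)"
  have s: "0 < ?s" using \<sigma> \<theta> by simp
  have int: "integrable M (\<lambda>\<omega>. exp (?s * Y \<omega>))"
    by (rule integrableI_nonneg) (use Y le in \<open>auto simp: order.strict_trans1[OF _ ennreal_less_top]\<close>)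
  have "ennreal (\<integral>\<omega>. exp (?s * Y \<omega>) \<partial>M) = (\<integral>\<^sup>+\<omega>. ennreal (exp (?s * Y \<omega>)) \<partial>M)"
    using int by (intro nn_integral_eq_integral[symmetric]) auto
  then have E: "(\<integral>\<omega>. exp (?s * Y \<omega>) \<partial>M) \<le> exp (?s * a)"
    using le by (metis ennreal_le_iff exp_ge_zero)
  have "0 < (\<integral>\<omega>. exp (?s * Y \<omega>) \<partial>M)"
  proof -
    \<comment> \<open>The logarithm of the mean is monotone only once the mean is known to be positive.\<close>
    have "(\<integral>\<omega>. exp (?s * Y \<omega>) \<partial>M) \<noteq> 0"
    proof
      assume "(\<integral>\<omega>. exp (?s * Y \<omega>) \<partial>M) = 0"
      then have "AE \<omega> in M. exp (?s * Y \<omega>) = 0"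
        using int by (subst (asm) integral_nonneg_eq_0_iff_AE) auto
      then have "AE \<omega> in M. False" by simp
      then show False by (simp add: AE_False)
    qed
    moreover have "0 \<le> (\<integral>\<omega>. exp (?s * Y \<omega>) \<partial>M)" by (rule integral_nonneg_AE) simp
    ultimately show ?thesis by linarith
  qed
  then have "ln (\<integral>\<omega>. exp (?s * Y \<omega>) \<partial>M) \<le> ?s * a"
    using E by (metis ln_exp ln_mono)
  then have "2 * \<sigma>\<^sup>2 / \<theta> * ln (\<integral>\<omega>. exp (?s * Y \<omega>) \<partial>M) \<le> 2 * \<sigma>\<^sup>2 / \<theta> * (?s * a)"
    using \<theta> by (intro mult_left_mono) auto
  also have "2 * \<sigma>\<^sup>2 / \<theta> * (?s * a) = a" using \<sigma> \<theta> by simp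
  finally show ?thesis using int \<open>a < c\<close> by (simp add: entropic_risk_def)
qed
theorem proposition6:
  fixes f :: "real^'n \<Rightarrow> real"
    and M :: "'w measure"
    and w :: "nat \<Rightarrow> 'w \<Rightarrow> real^'n"
    and x0 xm1 xstar :: "real^'n"
    and \<mu> L \<sigma> \<theta> vartheta \<psi> \<alpha> \<beta> \<gamma> rho_sq lambda_P v_hat rho_hat_sq :: real
  assumes "0 < \<mu>" and "\<mu> < L"
    and "strongly_convex \<mu> f" and "smooth L f"
    and "unique_minimizer f xstar"
    and "gmm_parameters \<mu> L vartheta \<psi> \<alpha> \<beta> \<gamma>"
    and "prob_space M" and "0 < \<sigma>"
    and "subgaussian_noise M (gmm f \<alpha> \<beta> \<gamma> x0 xm1 w) w \<sigma>"
    and "rho_sq = 1 - sqrt (vartheta * \<alpha> * \<mu>)"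
    and "lambda_P = vartheta / (2 * \<alpha>)"
    and "v_hat = 2 * L\<^sup>2 / \<mu> * (2 * (\<beta> - \<gamma>)\<^sup>2 + (1 - \<alpha> * L)\<^sup>2 * (1 + 2 * \<gamma> + 2 * \<gamma>\<^sup>2)) + lambda_P * rho_sq"
    and "0 < \<theta>"
    and "\<theta> < min ((1 - rho_sq) / (64 * \<alpha>\<^sup>2 * v_hat)) (1 / (4 * \<alpha>\<^sup>2 * (L + 2 * lambda_P)))"
    and "rho_hat_sq = 1 / 2 * (rho_sq + 32 * \<alpha>\<^sup>2 * v_hat * \<theta>)
           + 1 / 2 * sqrt ((rho_sq + 32 * \<alpha>\<^sup>2 * v_hat * \<theta>)\<^sup>2 + 128 * \<alpha>\<^sup>2 * v_hat * \<theta>)"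
  shows "rho_hat_sq < 1 \<and>
    (\<forall>k. entropic_risk M \<sigma> \<theta> (\<lambda>\<omega>. f (gmm f \<alpha> \<beta> \<gamma> x0 xm1 w k \<omega>) - f xstar)
      < ereal (4 * \<sigma>\<^sup>2 * \<alpha>\<^sup>2 * (L + 2 * lambda_P) / (1 - rho_hat_sq)
          + rho_hat_sq ^ k * (2 * lyapunov f xstar (P_matrix \<mu> vartheta \<alpha>) (stack x0 xm1))))"
proof -
  interpret prob_space M by fact
  note par = gmm_parameters_facts[OF assms(1,2,6)]
  note \<mu> = assms(1,2) and f = assms(4,3) and \<sigma> = assms(8) and noise = assms(9) and \<theta> = assms(13)
  have L: "0 < L" using \<mu> by simp
  have min: "f xstar \<le> f y" for y
    using assms(5) unfolding unique_minimizer_def is_arg_min_linorder by blast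
  define p where "p = sqrt (vartheta / (2 * \<alpha>))"
  define m where "m = sqrt (\<mu> / 2)"
  define r where "r = sqrt (vartheta * \<alpha> * \<mu>)"
  have p: "0 < p" "2 * \<alpha> * p\<^sup>2 = vartheta" and m: "0 < m" "2 * m\<^sup>2 = \<mu>"
    using par(1,2) \<mu> by (simp_all add: p_def m_def)
  have p_sq: "p\<^sup>2 = lambda_P" using par(1,2) by (simp add: p_def assms(11))
  have r: "r = 2 * \<alpha> * p * m"
  proof -
    have "vartheta * \<alpha> * \<mu> = (2 * \<alpha> * p * m)\<^sup>2"
      unfolding p(2)[symmetric] m(2)[symmetric] by (simp add: power2_eq_square)
    then show ?thesis using par(1) p m by (simp add: r_def)
  qed
  have r01: "0 < r" "r < 1" using par(1,2,3) \<mu> by (simp_all add: r_def)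
  have rho: "rho_sq = 1 - r" by (simp add: assms(10) r_def)
  have \<beta>\<gamma>: "\<beta> = (1 - r) / (1 - \<alpha> * \<psi> * \<mu>) * (1 - sqrt (\<alpha> * \<mu> / vartheta))" "\<gamma> = \<psi> * \<beta>"
    using assms(6) unfolding gmm_parameters_def r_def by auto
  have \<beta>: "\<beta> * p * (1 - \<alpha> * \<mu> * \<psi>) = (1 - r) * (p - m)"
  proof -
    have "\<alpha> * \<mu> / vartheta = (m / p)\<^sup>2"
      unfolding p(2)[symmetric] m(2)[symmetric] using par(1) p(1) by (simp add: power_divide)
    then have "sqrt (\<alpha> * \<mu> / vartheta) = m / p" using p m by simp
    then have "p * (1 - sqrt (\<alpha> * \<mu> / vartheta)) = p - m" using p by (simp add: right_diff_distrib)
    moreover have "1 - \<alpha> * \<psi> * \<mu> \<noteq> 0" using par(7) by (simp add: mult_ac)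
    then have "\<beta> * (1 - \<alpha> * \<psi> * \<mu>) = (1 - r) * (1 - sqrt (\<alpha> * \<mu> / vartheta))"
      unfolding \<beta>\<gamma>(1) by simp
    then have "\<beta> * p * (1 - \<alpha> * \<psi> * \<mu>) = (1 - r) * (p * (1 - sqrt (\<alpha> * \<mu> / vartheta)))"
      by (metis mult.commute mult.left_commute)
    ultimately show ?thesis by (simp only: mult.assoc mult.commute[of \<psi>])
  qed

  have v: "lambda_P * rho_sq \<le> v_hat" "0 < v_hat"
  proof -
    have "0 \<le> 2 * L\<^sup>2 / \<mu> * (2 * (\<beta> - \<gamma>)\<^sup>2 + (1 - \<alpha> * L)\<^sup>2 * (1 + 2 * \<gamma> + 2 * \<gamma>\<^sup>2))"
    proof -
      have "1 + 2 * \<gamma> + 2 * \<gamma>\<^sup>2 = (1 + \<gamma>)\<^sup>2 + \<gamma>\<^sup>2" by (simp add: power2_eq_square algebra_simps)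
      then have "0 \<le> 1 + 2 * \<gamma> + 2 * \<gamma>\<^sup>2" by (metis add_nonneg_nonneg zero_le_power2)
      then have "0 \<le> (1 - \<alpha> * L)\<^sup>2 * (1 + 2 * \<gamma> + 2 * \<gamma>\<^sup>2)"
        by (rule mult_nonneg_nonneg[OF zero_le_power2])
      then have "0 \<le> 2 * (\<beta> - \<gamma>)\<^sup>2 + (1 - \<alpha> * L)\<^sup>2 * (1 + 2 * \<gamma> + 2 * \<gamma>\<^sup>2)"
        by (rule add_nonneg_nonneg[rotated]) simp
      then show ?thesis using \<mu> by (intro mult_nonneg_nonneg[of "2 * L\<^sup>2 / \<mu>"]) auto
    qed
    then show "lambda_P * rho_sq \<le> v_hat" by (simp add: assms(12))
    moreover have "0 < lambda_P * rho_sq"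
      using p(1) r01 unfolding rho p_sq[symmetric] by simp
    ultimately show "0 < v_hat" by linarith
  qed
  \<comment> \<open>By \<open>\<alpha> * L \<le> 3 * vartheta\<close> the summand \<open>lambda_P * rho_sq\<close> of \<open>v_hat\<close> alone is large enough.\<close>
  have v16: "(2 * L + 4 * p\<^sup>2) * rho_sq \<le> 16 * v_hat"
  proof -
    have "\<alpha> * L \<le> \<alpha> * (6 * p\<^sup>2)" using par(6) p(2) by (simp add: algebra_simps)
    then have "L \<le> 6 * p\<^sup>2" using par(1) by simp
    then have "(2 * L + 4 * p\<^sup>2) * rho_sq \<le> (16 * p\<^sup>2) * rho_sq"
      using r01 by (intro mult_right_mono) (auto simp: rho)
    also have "\<dots> \<le> 16 * v_hat" using v(1) by (simp add: p_sq)
    finally show ?thesis .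
  qed

  define B where "B = 32 * \<alpha>\<^sup>2 * v_hat * \<theta>"
  define q where "q = rho_sq + 64 * \<alpha>\<^sup>2 * v_hat * \<theta>"
  have B0: "0 \<le> B" using v \<theta> by (simp add: B_def)
  have B1: "2 * B < 1 - rho_sq"
  proof -
    have "\<theta> < (1 - rho_sq) / (64 * \<alpha>\<^sup>2 * v_hat)" using assms(14) by simp
    moreover have "0 < 64 * \<alpha>\<^sup>2 * v_hat" using par(1) v by simp
    ultimately have "\<theta> * (64 * \<alpha>\<^sup>2 * v_hat) < 1 - rho_sq" by (simp only: pos_less_divide_eq)
    then show ?thesis by (simp add: B_def mult_ac)
  qed
  have q_B: "q = rho_sq + 2 * B" by (simp add: q_def B_def)
  have rho0: "0 \<le> rho_sq" using r01 by (simp add: rho)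
  have hat: "rho_hat_sq = 1 / 2 * (rho_sq + B) + 1 / 2 * sqrt ((rho_sq + B)\<^sup>2 + 4 * B)"
    unfolding assms(15) B_def by (simp add: mult.assoc)
  have q_le: "q \<le> rho_hat_sq" and hat1: "rho_hat_sq < 1"
    using rate_bounds[OF rho0 B0 B1 hat] by (simp_all add: q_B)
  have q01: "0 \<le> q" "q < 1" using rho0 B0 q_le hat1 by (auto simp: q_B)

  define c where "c = 8 / 3 * \<sigma>\<^sup>2 * \<alpha>\<^sup>2 * (L + 2 * p\<^sup>2)"
  have c: "0 < c" using \<sigma> par(1) L by (auto simp: c_def intro!: mult_pos_pos add_pos_nonneg)
  have \<theta>2: "4 * \<theta> * \<alpha>\<^sup>2 * (L + 2 * p\<^sup>2) \<le> 1"
  proof -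
    have "\<theta> < 1 / (4 * \<alpha>\<^sup>2 * (L + 2 * p\<^sup>2))" using assms(14) by (simp add: p_sq)
    moreover have "0 < 4 * \<alpha>\<^sup>2 * (L + 2 * p\<^sup>2)"
      using par(1) L by (auto intro!: mult_pos_pos add_pos_nonneg)
    ultimately have "\<theta> * (4 * \<alpha>\<^sup>2 * (L + 2 * p\<^sup>2)) < 1" by (simp only: pos_less_divide_eq)
    then show ?thesis by (simp add: mult_ac)
  qed

  have cont[measurable]: "f \<in> borel_measurable borel" "grad f \<in> borel_measurable borel"
    using continuous_on_smooth[OF f(1)] by (auto intro: borel_measurable_continuous_onI)
  note noise' = subgaussian_noise_unconditional[OF noise \<sigma> cont(2)]
  note w[measurable] = noise'(1)
  define st where "st k \<omega> = gmm_state f \<alpha> \<beta> \<gamma> x0 xm1 (\<lambda>j. w j \<omega>) k" for k \<omega>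
  have st[measurable]: "(\<lambda>\<omega>. fst (st k \<omega>)) \<in> borel_measurable M" "(\<lambda>\<omega>. snd (st k \<omega>)) \<in> borel_measurable M" for k
    unfolding st_def by (intro borel_measurable_gmm_state cont w)+
  define V where "V k \<omega> = energy f xstar p m (fst (st k \<omega>)) (snd (st k \<omega>))" for k \<omega>
  have V_meas: "V k \<in> borel_measurable M" for k
    unfolding V_def[abs_def] energy_def by measurable
  define xb where "xb z = (1 + \<beta>) *\<^sub>R fst z - \<beta> *\<^sub>R snd z
      - \<alpha> *\<^sub>R grad f ((1 + \<gamma>) *\<^sub>R fst z - \<gamma> *\<^sub>R snd z)" for z
  have st_Suc: "st (Suc k) \<omega> = (xb (st k \<omega>) - \<alpha> *\<^sub>R w (Suc k) \<omega>, fst (st k \<omega>))" for k \<omega>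
    by (simp add: st_def xb_def Let_def split_beta algebra_simps)
  have step: "(\<integral>\<^sup>+\<omega>. ennreal (exp (\<tau> * V (Suc k) \<omega>)) \<partial>M) \<le> (\<integral>\<^sup>+\<omega>. ennreal (exp (\<tau> * (q * V k \<omega> + c))) \<partial>M)"
    if \<tau>: "0 \<le> \<tau>" "\<tau> \<le> \<theta> / (2 * \<sigma>\<^sup>2)" for k \<tau>
  proof -
    define h where "h zw = ennreal (exp (\<tau> * energy f xstar p m (xb (fst zw) - \<alpha> *\<^sub>R snd zw) (fst (fst zw))))"
      for zw :: "((real^'n) \<times> (real^'n)) \<times> (real^'n)"
    have \<tau>2: "2 * \<sigma>\<^sup>2 * \<tau> \<le> \<theta>" using \<tau>(2) \<sigma> by (simp add: field_simps)
    have "h \<in> borel_measurable ((borel \<Otimes>\<^sub>M borel) \<Otimes>\<^sub>M borel)"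
      unfolding h_def[abs_def] energy_def xb_def by measurable
    then have h: "h \<in> borel_measurable (borel \<Otimes>\<^sub>M borel)" by (simp only: borel_prod)
    have st_k: "st k \<in> borel_measurable M"
      using borel_measurable_Pair[OF st(1)[of k] st(2)[of k]] by simp
    have "(\<integral>\<^sup>+\<omega>. ennreal (exp (\<tau> * V (Suc k) \<omega>)) \<partial>M) = (\<integral>\<^sup>+\<omega>. h (st k \<omega>, w (Suc k) \<omega>) \<partial>M)"
      by (simp add: V_def h_def st_Suc)
    also have "\<dots> = (\<integral>\<^sup>+\<omega>. (\<integral>\<^sup>+\<omega>'. h (st k \<omega>, w (Suc k) \<omega>') \<partial>M) \<partial>M)"
      using noise'(4)[of k] unfolding st_def[symmetric]
      by (intro indep_set_nn_integral_iterated[OF st_k w _ h])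
    also have "\<dots> \<le> (\<integral>\<^sup>+\<omega>. ennreal (exp (\<tau> * (q * V k \<omega> + c))) \<partial>M)"
    proof (rule nn_integral_mono)
      fix \<omega>
      let ?x = "fst (st k \<omega>)" and ?x' = "snd (st k \<omega>)"
      have "energy f xstar p m (xb (st k \<omega>)) ?x \<le> rho_sq * V k \<omega>"
        unfolding xb_def V_def rho
        using par r01 p m \<beta> \<beta>\<gamma>(2)
        by (intro gmm_noiseless_contraction[where r = r, OF f]) (auto simp: r r_def[symmetric])
      moreover have "0 \<le> V k \<omega>" unfolding V_def by (rule energy_nonneg) (rule min)
      ultimately show "(\<integral>\<^sup>+\<omega>'. h (st k \<omega>, w (Suc k) \<omega>') \<partial>M) \<le> ennreal (exp (\<tau> * (q * V k \<omega> + c)))"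
        unfolding h_def fst_conv snd_conv q_def c_def
        by (intro energy_mgf_step[OF f(1) L min p(1) w noise'(2,3) \<sigma> _ _ v16 \<tau>(1) \<tau>2 \<theta>2])
    qed
    finally show ?thesis .
  qed

  define v0 where "v0 = lyapunov f xstar (P_matrix \<mu> vartheta \<alpha>) (stack x0 xm1)"
  have v0: "v0 = energy f xstar p m x0 xm1" by (simp add: v0_def lyapunov_eq_energy p_def m_def)
  have v0_nonneg: "0 \<le> v0" unfolding v0 by (rule energy_nonneg) (rule min)
  have "entropic_risk M \<sigma> \<theta> (\<lambda>\<omega>. f (gmm f \<alpha> \<beta> \<gamma> x0 xm1 w k \<omega>) - f xstar)
      < ereal (4 * \<sigma>\<^sup>2 * \<alpha>\<^sup>2 * (L + 2 * lambda_P) / (1 - rho_hat_sq) + rho_hat_sq ^ k * (2 * v0))" for k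
  proof (rule entropic_risk_less[OF \<open>prob_space M\<close> _ \<sigma> \<theta>])
    show "(\<lambda>\<omega>. f (gmm f \<alpha> \<beta> \<gamma> x0 xm1 w k \<omega>) - f xstar) \<in> borel_measurable M"
      unfolding gmm_def st_def[symmetric] by measurable
    let ?s = "\<theta> / (2 * \<sigma>\<^sup>2)"
    have s: "0 \<le> ?s" using \<theta> by simp
    have "f (gmm f \<alpha> \<beta> \<gamma> x0 xm1 w k \<omega>) - f xstar \<le> V k \<omega>" for \<omega>
      unfolding V_def gmm_def st_def by (rule energy_ge_gap)
    then have "(\<integral>\<^sup>+\<omega>. ennreal (exp (?s * (f (gmm f \<alpha> \<beta> \<gamma> x0 xm1 w k \<omega>) - f xstar))) \<partial>M)
        \<le> (\<integral>\<^sup>+\<omega>. ennreal (exp (?s * V k \<omega>)) \<partial>M)"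
      using s by (intro nn_integral_mono ennreal_leI exp_mono mult_left_mono) auto
    also have "\<dots> \<le> ennreal (exp (?s * (q ^ k * v0 + c * (\<Sum>i<k. q ^ i))))"
      using q01 s by (intro mgf_recursion[where T = ?s and V = V] step V_meas) (auto simp: V_def v0 st_def)
    finally show "(\<integral>\<^sup>+\<omega>. ennreal (exp (?s * (f (gmm f \<alpha> \<beta> \<gamma> x0 xm1 w k \<omega>) - f xstar))) \<partial>M)
        \<le> ennreal (exp (?s * (q ^ k * v0 + c * (\<Sum>i<k. q ^ i))))" .
    show "q ^ k * v0 + c * (\<Sum>i<k. q ^ i)
        < 4 * \<sigma>\<^sup>2 * \<alpha>\<^sup>2 * (L + 2 * lambda_P) / (1 - rho_hat_sq) + rho_hat_sq ^ k * (2 * v0)"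
    proof -
      have "(\<Sum>i<k. q ^ i) \<le> 1 / (1 - q)"
      proof -
        have "(1 - q) * (\<Sum>i<k. q ^ i) = 1 - q ^ k" by (rule one_diff_power_eq[symmetric])
        also have "\<dots> \<le> 1" using q01 by simp
        finally show ?thesis using q01 by (simp add: field_simps)
      qed
      also have "\<dots> \<le> 1 / (1 - rho_hat_sq)" using q_le hat1 by (intro divide_left_mono) auto
      finally have "c * (\<Sum>i<k. q ^ i) \<le> c * (1 / (1 - rho_hat_sq))" using c by (intro mult_left_mono) auto
      \<comment> \<open>The constant \<open>8 / 3\<close> in \<open>c\<close> against the claimed \<open>4\<close>: here the inequality becomes strict.\<close>
      also have "\<dots> < 3 / 2 * c * (1 / (1 - rho_hat_sq))"
        using c hat1 by (intro mult_strict_right_mono) auto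
      also have "\<dots> = 4 * \<sigma>\<^sup>2 * \<alpha>\<^sup>2 * (L + 2 * lambda_P) / (1 - rho_hat_sq)"
        by (simp add: c_def p_sq)
      finally have "c * (\<Sum>i<k. q ^ i) < 4 * \<sigma>\<^sup>2 * \<alpha>\<^sup>2 * (L + 2 * lambda_P) / (1 - rho_hat_sq)" .
      moreover have "q ^ k * v0 \<le> rho_hat_sq ^ k * (2 * v0)"
        using q_le q01 v0_nonneg by (intro mult_mono power_mono) auto
      ultimately show ?thesis by linarith
    qed
  qed
  then show ?thesis using hat1 unfolding v0_def by blast
qed

end
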